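(* Consider Problem $\mathrm{OLL}_\gamma^N$ (minimize the learning functional $J_\gamma^N$ over the admissible sequences of updating functions $u_0,\dots,u_{N-1}$), as described in the context. The updating functions that solve Problem $\mathrm{OLL}_\gamma^N$ are given, for $k=N-1,\dots,0$, by $$u_k^\circ(\tilde I_k)=L_k\,\mathbb{E}\{e_k^\circ\,|\,\tilde I_k\},$$ where $e_k^\circ$ denotes the error vector $e_k$ when the optimal updating functions are applied, $$L_k:=-(\overline K_{k+1}+\gamma I)^{-1}\overline K_{k+1},$$ and the matrices $$K_k:=\overline K_{k+1}-\overline K_{k+1}(\overline K_{k+1}+\gamma I)^{-1}\overline K_{k+1}+Q_k,$$ $$F_k:=\overline K_{k+1}(\overline K_{k+1}+\gamma I)^{-1}\overline K_{k+1},$$ $$\overline K_k:=\mathbb{E}\{K_k\}=\overline K_{k+1}-\overline K_{k+1}(\overline K_{k+1}+\gamma I)^{-1}\overline K_{k+1}+\mathbb{E}\{Q_k\}$$ are symmetric positive-semidefinite; the recursions are initialized by $K_N:=Q_N$ and $\overline K_N:=\mathbb{E}\{K_N\}$.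
   Context: A prime denotes transpose, $I$ is the $d\times d$ identity matrix, $N\ge 1$ is an integer and $\gamma>0$. Data model: $w\in\mathbb{R}^d$ is a random vector, $x_k\in\mathbb{R}^d$ and $\varepsilon_k\in\mathbb{R}$ ($k=0,1,\dots$) are random inputs and noises; the random variables $w,\{x_k\},\{\varepsilon_k\}$ are mutually independent and have mean $0$; $w$ has covariance matrix $\Sigma_w$, the $\varepsilon_k$ have the same variance $\sigma_\varepsilon^2$, and each $x_k$ has finite covariance matrix $\mathbb{E}\{x_kx_k'\}$. The outputs are $y_k=w'x_k+\varepsilon_k$. Put $C_k:=x_k'$ and $Q_k:=x_kx_k'$. Learning machine: $\hat w_0:=0$, $\hat w_{k+1}=\hat w_k+u_k$. The update $u_k\in\mathbb{R}^d$ is chosen as a function $u_k(I_k)$ (an updating function) of the information vector $I_k:=\{(x_j,y_j),\ j=0,\dots,k;\ u_j,\ j=0,\dots,k-1\}$ ($I_0:=\{(x_0,y_0)\}$). Error: $e_k:=\hat w_k-w$, so $e_0=-w$, $e_{k+1}=e_k+u_k$. Put $\tilde y_k:=\hat w_k'x_k-y_k=C_ke_k-\varepsilon_k$ and $\tilde I_k:=\{(x_j,\tilde y_j),\ j=0,\dots,k;\ u_j,\ j=0,\dots,k-1\}$ ($\tilde I_0:=\{(x_0,\tilde y_0)\}$). $I_k$ and $\tilde I_k$ are in one-to-one correspondence, so updating functions may equivalently be written as $u_k(\tilde I_k)$. Learning functional: $$J_\gamma^N(\{u_k\}_{k=0}^{N-1}):=\mathbb{E}\Big\{\sum_{k=0}^{N-1}\big[e_k'Q_ke_k+\gamma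 u_k'u_k\big]+e_N'Q_Ne_N\Big\}.$$ Problem $\mathrm{OLL}_\gamma^N$: find the sequence $u_0^\circ,\dots,u_{N-1}^\circ$ of updating functions, with the information structure above, that minimizes $J_\gamma^N$. *)

theory Defs
  imports "HOL-Probability.Probability"
begin

section \<open>Matrices\<close>

definition outer :: "real^'d \<Rightarrow> real^'d \<Rightarrow> real^'d^'d" where
  "outer v v' = (\<chi> i j. v $ i * v' $ j)"

definition sym_psd :: "real^'d^'d \<Rightarrow> bool" where
  "sym_psd A \<longleftrightarrow> transpose A = A \<and> (\<forall>v. 0 \<le> v \<bullet> (A *v v))"


section \<open>Random data\<close>

definition has_covariance :: "'a measure \<Rightarrow> ('a \<Rightarrow> real^'d) \<Rightarrow> real^'d^'d \<Rightarrow> bool" where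
  "has_covariance M X S \<longleftrightarrow>
     (let m = integral\<^sup>L M X in
       integrable M X \<and>
       integrable M (\<lambda>\<omega>. outer (X \<omega> - m) (X \<omega> - m)) \<and>
       integral\<^sup>L M (\<lambda>\<omega>. outer (X \<omega> - m) (X \<omega> - m)) = S)"

text \<open>
  Mutual independence of \<open>w\<close>, all \<open>x\<^sub>k\<close> and all \<open>\<epsilon>\<^sub>k\<close>. The variables have different
  codomains, so \<^const>\<open>prob_space.indep_vars\<close> does not apply to the joint family; the families of
  preimages below are the ones to which its definition reduces independence.
\<close>

datatype source = Param | Input nat | Noise nat

definition preimages :: "'a measure \<Rightarrow> ('a \<Rightarrow> 'b::topological_space) \<Rightarrow> 'a set set" where
  "preimages M X = {X -` A \<inter> space M | A. A \<in> sets borel}"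

definition mutually_independent ::
  "'a measure \<Rightarrow> ('a \<Rightarrow> real^'d) \<Rightarrow> (nat \<Rightarrow> 'a \<Rightarrow> real^'d) \<Rightarrow> (nat \<Rightarrow> 'a \<Rightarrow> real) \<Rightarrow> bool" where
  "mutually_independent M w x eps \<longleftrightarrow>
     prob_space.indep_sets M
       (\<lambda>s. case s of Param \<Rightarrow> preimages M w
                    | Input k \<Rightarrow> preimages M (x k)
                    | Noise k \<Rightarrow> preimages M (eps k)) UNIV"

definition outcome ::
  "('a \<Rightarrow> real^'d) \<Rightarrow> (nat \<Rightarrow> 'a \<Rightarrow> real^'d) \<Rightarrow> (nat \<Rightarrow> 'a \<Rightarrow> real) \<Rightarrow> nat \<Rightarrow> 'a \<Rightarrow> real" where
  "outcome w x eps k \<omega> = w \<omega> \<bullet> x k \<omega> + eps k \<omega>"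

definition Qmat :: "(nat \<Rightarrow> 'a \<Rightarrow> real^'d) \<Rightarrow> nat \<Rightarrow> 'a \<Rightarrow> real^'d^'d" where
  "Qmat x k \<omega> = outer (x k \<omega>) (x k \<omega>)"


section \<open>Information vectors and updating functions\<close>

text \<open>
  A value of the \<open>k\<close>-th information vector is a pair consisting of a sequence of
  input-output pairs, indexed by \<open>{..k}\<close>, and a sequence of past updates, indexed by \<open>{..<k}\<close>;
  both are \<^const>\<open>undefined\<close> outside these index sets, as in \<^const>\<open>PiM\<close>.
\<close>

type_synonym 'd info = "(nat \<Rightarrow> (real^'d) \<times> real) \<times> (nat \<Rightarrow> real^'d)"

type_synonym 'd policy = "nat \<Rightarrow> 'd info \<Rightarrow> real^'d"

definition info_space :: "nat \<Rightarrow> ('d::finite) info measure" where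
  "info_space k = PiM {..k} (\<lambda>_. borel) \<Otimes>\<^sub>M PiM {..<k} (\<lambda>_. borel)"

definition updating_functions :: "nat \<Rightarrow> ('d::finite) policy set" where
  "updating_functions N = {u. \<forall>k<N. u k \<in> borel_measurable (info_space k)}"

text \<open>
  The map \<open>I\<^sub>k \<mapsto> \<tilde>I\<^sub>k\<close> replacing \<open>y\<^sub>j\<close> by \<open>(u\<^sub>0 + \<dots> + u\<^sub>j\<^sub>-\<^sub>1)' x\<^sub>j - y\<^sub>j\<close>. It is an involution,
  hence also the map \<open>\<tilde>I\<^sub>k \<mapsto> I\<^sub>k\<close>; \<open>u k \<circ> tilde k\<close> is the updating function \<open>u k\<close> written as a
  function of \<open>\<tilde>I\<^sub>k\<close>.
\<close>

definition tilde :: "nat \<Rightarrow> ('d::finite) info \<Rightarrow> 'd info" where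
  "tilde k = (\<lambda>(xy, us).
     (\<lambda>j\<in>{..k}. (fst (xy j), (\<Sum>i<j. us i) \<bullet> fst (xy j) - snd (xy j)), us))"

lemma tilde_tilde: "xy \<in> extensional {..k} \<Longrightarrow> tilde k (tilde k (xy, us)) = (xy, us)"
  by (auto simp: tilde_def extensional_def fun_eq_iff)


section \<open>The learning machine\<close>

lemma restrict_fundef_cong:
  "A = B \<Longrightarrow> (\<And>i. i \<in> B \<Longrightarrow> f i = g i) \<Longrightarrow> restrict f A = restrict g B"
  by auto

context
  fixes w :: "'a \<Rightarrow> real^'d::finite"
    and x :: "nat \<Rightarrow> 'a \<Rightarrow> real^'d"
    and eps :: "nat \<Rightarrow> 'a \<Rightarrow> real"
    and u :: "'d policy"
begin

context
  notes restrict_fundef_cong [fundef_cong]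
begin

text \<open>The value \<open>u\<^sub>k\<close> that the policy produces along the realization \<open>\<omega>\<close>.\<close>

fun update :: "nat \<Rightarrow> 'a \<Rightarrow> real^'d" where
  "update k \<omega> = u k (\<lambda>j\<in>{..k}. (x j \<omega>, outcome w x eps j \<omega>), \<lambda>j\<in>{..<k}. update j \<omega>)"

end

declare update.simps [simp del]

definition info :: "nat \<Rightarrow> 'a \<Rightarrow> 'd info" where
  "info k \<omega> = (\<lambda>j\<in>{..k}. (x j \<omega>, outcome w x eps j \<omega>), \<lambda>j\<in>{..<k}. update j \<omega>)"

primrec estimate :: "nat \<Rightarrow> 'a \<Rightarrow> real^'d" where
  "estimate 0 \<omega> = 0"
| "estimate (Suc k) \<omega> = estimate k \<omega> + update k \<omega>"

definition err :: "nat \<Rightarrow> 'a \<Rightarrow> real^'d" where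
  "err k \<omega> = estimate k \<omega> - w \<omega>"

definition outcome_err :: "nat \<Rightarrow> 'a \<Rightarrow> real" where
  "outcome_err k \<omega> = estimate k \<omega> \<bullet> x k \<omega> - outcome w x eps k \<omega>"

definition tilde_info :: "nat \<Rightarrow> 'a \<Rightarrow> 'd info" where
  "tilde_info k \<omega> = (\<lambda>j\<in>{..k}. (x j \<omega>, outcome_err j \<omega>), \<lambda>j\<in>{..<k}. update j \<omega>)"

text \<open>
  The integrand is nonnegative for \<open>\<gamma> \<ge> 0\<close>; the functional is extended-valued, so that it
  is defined for every sequence of (measurable) updating functions.
\<close>

definition learning_functional :: "'a measure \<Rightarrow> real \<Rightarrow> nat \<Rightarrow> ennreal" where
  "learning_functional M \<gamma> N =
     (\<integral>\<^sup>+ \<omega>. ennreal ((\<Sum>k<N. (err k \<omega> \<bullet> (Qmat x k \<omega> *v err k \<omega>) + \<gamma> * (update k \<omega> \<bullet> update k \<omega>)))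
                     + err N \<omega> \<bullet> (Qmat x N \<omega> *v err N \<omega>)) \<partial>M)"

lemma update_info: "update k \<omega> = u k (info k \<omega>)"
  by (subst update.simps) (simp add: info_def)

lemma outcome_err_eq: "outcome_err k \<omega> = x k \<omega> \<bullet> err k \<omega> - eps k \<omega>"
  by (simp add: outcome_err_def err_def outcome_def inner_diff_right inner_commute)

lemma estimate_eq_sum: "estimate k \<omega> = (\<Sum>j<k. update j \<omega>)"
  by (induction k) auto

lemma tilde_info: "tilde k (info k \<omega>) = tilde_info k \<omega>"
proof -
  have "(\<Sum>i<j. restrict (\<lambda>j. update j \<omega>) {..<k} i) = estimate j \<omega>" if "j \<le> k" for j
    unfolding estimate_eq_sum using that by (intro sum.cong) auto
  then show ?thesis
    by (auto simp: tilde_def info_def tilde_info_def outcome_err_def fun_eq_iff restrict_def)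
qed

lemma tilde_tilde_info: "tilde k (tilde_info k \<omega>) = info k \<omega>"
proof -
  have "(\<Sum>i<j. restrict (\<lambda>j. update j \<omega>) {..<k} i) = estimate j \<omega>" if "j \<le> k" for j
    unfolding estimate_eq_sum using that by (intro sum.cong) auto
  then show ?thesis
    by (auto simp: tilde_def info_def tilde_info_def outcome_err_def fun_eq_iff restrict_def)
qed

end

definition solves_OLL ::
  "'a measure \<Rightarrow> ('a \<Rightarrow> real^'d::finite) \<Rightarrow> (nat \<Rightarrow> 'a \<Rightarrow> real^'d) \<Rightarrow> (nat \<Rightarrow> 'a \<Rightarrow> real)
    \<Rightarrow> real \<Rightarrow> nat \<Rightarrow> 'd policy \<Rightarrow> bool" where
  "solves_OLL M w x eps \<gamma> N u \<longleftrightarrow>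
     u \<in> updating_functions N \<and>
     (\<forall>v\<in>updating_functions N.
        learning_functional w x eps u M \<gamma> N \<le> learning_functional w x eps v M \<gamma> N)"

text \<open>
  Conditional expectation, component by component, of a random vector given the
  \<open>\<sigma>\<close>-algebra generated by a random variable \<open>Z\<close> with values in \<open>S\<close>.
\<close>

definition cond_exp_given ::
  "'a measure \<Rightarrow> ('a \<Rightarrow> real^'d) \<Rightarrow> ('a \<Rightarrow> 'z) \<Rightarrow> 'z measure \<Rightarrow> 'a \<Rightarrow> real^'d" where
  "cond_exp_given M X Z S \<omega> =
     (\<chi> i. real_cond_exp M (vimage_algebra (space M) Z S) (\<lambda>\<omega>'. X \<omega>' $ i) \<omega>)"


section \<open>The matrix recursions\<close>

context
  fixes M :: "'a measure" and x :: "nat \<Rightarrow> 'a \<Rightarrow> real^'d::finite"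
    and \<gamma> :: real and N :: nat
begin

text \<open>
  \<open>Kmat k\<close> is a random matrix, obtained backwards from \<open>Kmat N\<close>; indices \<open>k > N\<close> are irrelevant.
\<close>

function Kmat :: "nat \<Rightarrow> 'a \<Rightarrow> real^'d^'d" where
  "Kmat k = (if k < N
          then (let B = integral\<^sup>L M (Kmat (Suc k)) in
                  (\<lambda>\<omega>. B - B ** matrix_inv (B + \<gamma> *\<^sub>R mat 1) ** B + Qmat x k \<omega>))
          else Qmat x N)"
  by auto
termination by (relation "Wellfounded.measure (\<lambda>k. N - k)") auto

declare Kmat.simps [simp del]

definition Kbar :: "nat \<Rightarrow> real^'d^'d" where
  "Kbar k = integral\<^sup>L M (Kmat k)"

definition Fmat :: "nat \<Rightarrow> real^'d^'d" where
  "Fmat k = Kbar (Suc k) ** matrix_inv (Kbar (Suc k) + \<gamma> *\<^sub>R mat 1) ** Kbar (Suc k)"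

definition Lmat :: "nat \<Rightarrow> real^'d^'d" where
  "Lmat k = - (matrix_inv (Kbar (Suc k) + \<gamma> *\<^sub>R mat 1) ** Kbar (Suc k))"

lemma K_N: "Kmat N = Qmat x N"
  by (simp add: Kmat.simps)

lemma K_step:
  "k < N \<Longrightarrow> Kmat k \<omega> = Kbar (Suc k)
     - Kbar (Suc k) ** matrix_inv (Kbar (Suc k) + \<gamma> *\<^sub>R mat 1) ** Kbar (Suc k) + Qmat x k \<omega>"
  by (subst Kmat.simps) (simp add: Kbar_def Let_def)

end

end

theory Submission
  imports Defs
begin

text \<open>
  Write \<open>S\<^sub>k = K\<^sub>k\<^sub>+\<^sub>1 + \<gamma> I\<close> with the mean matrices \<open>K\<^sub>k\<close>. The error \<open>e\<^sub>k\<close> is a function of \<open>w\<close> and of the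
  data before time \<open>k\<close>, hence independent of \<open>x\<^sub>k\<close>, so \<open>Q\<^sub>k\<close> may be replaced by its mean in the
  expected cost. Completing the square and telescoping gives
  \<open>J(u) = E(w' K\<^sub>0 w) + (\<Sum>k<N. E((u\<^sub>k - L\<^sub>k e\<^sub>k)' S\<^sub>k (u\<^sub>k - L\<^sub>k e\<^sub>k)))\<close>
  whenever all updates are square-integrable, as they are when \<open>J(u)\<close> is finite.
  The \<open>\<sigma>\<close>-algebra generated by the information vector does not depend on the policy: it is
  generated by the observed data. So \<open>e\<^sub>k - E(e\<^sub>k | I\<^sub>k) = E(w | I\<^sub>k) - w\<close> is the same for all policies and
  orthogonal to \<open>u\<^sub>k - L\<^sub>k E(e\<^sub>k | I\<^sub>k)\<close>, and \<open>J(u)\<close> is a constant plus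
  the expected \<open>S\<^sub>k\<close>-quadratic forms of the latter. As \<open>S\<^sub>k\<close> is positive definite, the minimizers are
  exactly the policies for which all of these vanish almost surely, and one exists because
  \<open>E(w | I\<^sub>k)\<close> is a measurable function of the data.
\<close>

section \<open>Completing the square\<close>

lemma symmetric_inner_matrix:
  fixes A :: "real^'n^'n"
  assumes "transpose A = A"
  shows "v \<bullet> (A *v z) = (A *v v) \<bullet> z"
  using dot_lmul_matrix[of v A z] transpose_matrix_vector[of A v] assms by simp

lemma
  fixes A :: "real^'n^'n"
  assumes "invertible A"
  shows matrix_inv_mult_right: "A ** matrix_inv A = mat 1"
    and matrix_inv_mult_left: "matrix_inv A ** A = mat 1"
  using someI_ex[OF assms[unfolded invertible_def]] by (auto simp: matrix_inv_def)

text \<open>Transposing \<open>matrix_inv A ** A = mat 1\<close> makes the transposed inverse a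
  right inverse of \<open>A\<close>, and a right inverse must equal
  \<open>matrix_inv A\<close>.\<close>

lemma transpose_matrix_inv:
  fixes A :: "real^'n^'n"
  assumes inv: "invertible A" and sym: "transpose A = A"
  shows "transpose (matrix_inv A) = matrix_inv A"
proof -
  have "A ** transpose (matrix_inv A) = mat 1"
    using arg_cong[OF matrix_inv_mult_left[OF inv], of transpose] sym
    by (simp add: matrix_transpose_mul)
  then have "matrix_inv A ** (A ** transpose (matrix_inv A)) = matrix_inv A"
    by simp
  then show ?thesis
    by (simp add: matrix_mul_assoc matrix_inv_mult_left[OF inv])
qed

lemma transpose_add: "transpose (A + B) = transpose A + transpose (B :: real^'n^'m)"
  and transpose_diff: "transpose (A - B) = transpose A - transpose (B :: real^'n^'m)"
  by (auto simp: transpose_def vec_eq_iff)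

lemma uminus_matrix_vec: "(- A) *v v = - (A *v v)" for A :: "real^'n^'m"
  by (simp add: matrix_vector_mult_def vec_eq_iff sum_negf)

lemma matrix_vec_uminus: "A *v (- v) = - (A *v v)" for A :: "real^'n^'m"
  by (simp add: matrix_vector_mult_def vec_eq_iff sum_negf)

lemma shift_mult_vec: "(B + \<gamma> *\<^sub>R mat 1) *v v = B *v v + \<gamma> *\<^sub>R (v :: real^'n)"
  by (simp add: matrix_vector_mult_add_rdistrib scaleR_matrix_vector_assoc[symmetric])

lemma inner_outer_self: "e \<bullet> (outer v v *v e) = (v \<bullet> e)\<^sup>2"
  by (simp add: outer_def matrix_vector_mult_def inner_vec_def power2_eq_square sum_product
      sum_distrib_left mult_ac)

lemma sym_psd_outer: "sym_psd (outer v v)"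
  unfolding sym_psd_def inner_outer_self by (auto simp: outer_def transpose_def vec_eq_iff mult.commute)

lemma sym_psd_add: "sym_psd A \<Longrightarrow> sym_psd B \<Longrightarrow> sym_psd (A + B)"
  by (simp add: sym_psd_def transpose_add matrix_vector_mult_add_rdistrib inner_add_right)

text \<open>\<open>B + \<gamma> I\<close> is half the Hessian in \<open>u\<close> of the one-step cost \<open>(e + u)' B (e + u) + \<gamma> u' u\<close>.\<close>

context
  fixes B :: "real^'n^'n" and \<gamma> :: real
  assumes B: "sym_psd B" and \<gamma>: "\<gamma> > 0"
begin

private abbreviation (input) "S \<equiv> B + \<gamma> *\<^sub>R mat 1"

lemma shift_transpose: "transpose S = S"
  using B by (auto simp: sym_psd_def transpose_def vec_eq_iff mat_def)

text \<open>The margin \<gamma> forces a trivial kernel of \<open>S\<close> below, and later it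
  turns a vanishing expected form into an almost surely vanishing vector.\<close>

lemma shift_inner_ge: "v \<bullet> (S *v v) \<ge> \<gamma> * (v \<bullet> v)"
  using B by (simp add: shift_mult_vec inner_add_right sym_psd_def)

lemma shift_invertible: "invertible S"
proof -
  have "v = 0" if "S *v v = 0" for v
  proof -
    have "\<gamma> * (v \<bullet> v) \<le> 0"
      using shift_inner_ge[of v] that by simp
    then show ?thesis
      using \<gamma> by (simp add: mult_le_0_iff) (metis inner_eq_zero_iff inner_ge_zero order_antisym)
  qed
  then show ?thesis
    by (simp add: invertible_left_inverse matrix_left_invertible_ker)
qed

lemma shift_inv_mult: "S *v (matrix_inv S *v v) = v"
  by (simp add: matrix_vector_mul_assoc matrix_inv_mult_right[OF shift_invertible])

text \<open>The first-order condition in \<open>u\<close> reads \<open>S *v u = - (B *v e)\<close>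
  and is solved by \<open>L *v e\<close>. A quadratic function is its minimum plus the form of half
  its Hessian at the displacement from the minimizer.\<close>

lemma complete_square:
  fixes L F
  defines "L \<equiv> - (matrix_inv S ** B)" and "F \<equiv> B ** matrix_inv S ** B"
  shows "(e + u) \<bullet> (B *v (e + u)) + \<gamma> * (u \<bullet> u) =
    (u - L *v e) \<bullet> (S *v (u - L *v e)) + e \<bullet> ((B - F) *v e)"
proof -
  define l where "l = L *v e"
  have l_eq: "l = - (matrix_inv S *v (B *v e))"
    by (simp add: l_def L_def matrix_vector_mul_assoc uminus_matrix_vec)
  \<comment> \<open>This is the first-order condition at \<open>l\<close>; it eliminates the inverse
    from all cross terms.\<close>
  have Sl: "S *v l = - (B *v e)"
    unfolding l_eq by (simp add: matrix_vec_uminus shift_inv_mult)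
  have Fe: "F *v e = - (B *v l)"
    by (simp add: F_def l_eq matrix_vec_uminus matrix_vector_mul_assoc matrix_mul_assoc)
  have symS: "l \<bullet> (S *v u) = (S *v l) \<bullet> u"
    by (rule symmetric_inner_matrix[OF shift_transpose])
  have symB: "a \<bullet> (B *v b) = (B *v a) \<bullet> b" for a b
    using B by (intro symmetric_inner_matrix) (simp add: sym_psd_def)
  have "(u - l) \<bullet> (S *v (u - l)) = u \<bullet> (S *v u) - u \<bullet> (S *v l) - l \<bullet> (S *v u) + l \<bullet> (S *v l)"
    by (simp add: matrix_vector_mult_diff_distrib inner_diff_left inner_diff_right)
  also have "\<dots> = u \<bullet> (S *v u) + 2 * (u \<bullet> (B *v e)) - l \<bullet> (B *v e)"
    by (simp add: symS Sl inner_commute)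
  also have "u \<bullet> (S *v u) = u \<bullet> (B *v u) + \<gamma> * (u \<bullet> u)"
    by (simp add: shift_mult_vec inner_add_right)
  finally have 1: "(u - l) \<bullet> (S *v (u - l)) =
      u \<bullet> (B *v u) + \<gamma> * (u \<bullet> u) + 2 * (u \<bullet> (B *v e)) - l \<bullet> (B *v e)" .
  have 2: "e \<bullet> ((B - F) *v e) = e \<bullet> (B *v e) + l \<bullet> (B *v e)"
    using symB[of e l] by (simp add: matrix_vector_mult_diff_rdistrib Fe inner_diff_right inner_add_right)
      (rule inner_commute)
  show ?thesis
    unfolding l_def[symmetric] 1 2
    using symB[of e u] by (simp add: matrix_vector_right_distrib inner_add_left inner_add_right inner_commute)
qed

text \<open>With \<open>?z\<close> the solution of \<open>S *v ?z = B *v v\<close>, the form at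
  \<open>v\<close> equals the form of \<open>S\<close> at \<open>?z\<close>, so positivity of the
  inverse never has to be discussed.\<close>

lemma sym_psd_correction: "sym_psd (B ** matrix_inv S ** B)"
  unfolding sym_psd_def
proof safe
  show "transpose (B ** matrix_inv S ** B) = B ** matrix_inv S ** B"
    using B transpose_matrix_inv[OF shift_invertible shift_transpose]
    by (simp add: sym_psd_def matrix_transpose_mul matrix_mul_assoc)
  fix v
  let ?z = "matrix_inv S *v (B *v v)"
  have "v \<bullet> ((B ** matrix_inv S ** B) *v v) = v \<bullet> (B *v ?z)"
    by (simp add: matrix_vector_mul_assoc matrix_mul_assoc)
  also have "\<dots> = (B *v v) \<bullet> ?z"
    using B by (intro symmetric_inner_matrix) (simp add: sym_psd_def)
  also have "\<dots> = ?z \<bullet> (S *v ?z)"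
    by (simp only: shift_inv_mult inner_commute)
  finally show "0 \<le> v \<bullet> ((B ** matrix_inv S ** B) *v v)"
    using shift_inner_ge[of ?z] \<gamma> by (smt (verit) inner_ge_zero mult_nonneg_nonneg)
qed

text \<open>The form at \<open>v\<close> is the minimal one-step cost from error \<open>v\<close>:
  at the update \<open>z\<close> the square in \<open>complete_square\<close> vanishes, and the
  remaining cost is a sum of nonnegative terms.\<close>

lemma sym_psd_diff_correction: "sym_psd (B - B ** matrix_inv S ** B)"
  unfolding sym_psd_def
proof safe
  show "transpose (B - B ** matrix_inv S ** B) = B - B ** matrix_inv S ** B"
    using B sym_psd_correction by (simp add: sym_psd_def transpose_diff)
  fix v
  define z where "z = (- (matrix_inv S ** B)) *v v"
  have "0 \<le> (v + z) \<bullet> (B *v (v + z)) + \<gamma> * (z \<bullet> z)"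
    using B \<gamma> by (simp add: sym_psd_def)
  then show "0 \<le> v \<bullet> ((B - B ** matrix_inv S ** B) *v v)"
    using complete_square[of v z] by (simp add: z_def)
qed

end

section \<open>Square-integrable random vectors\<close>

text \<open>Measurability is part of the notion, since integrability of the squared norm alone does
  not yield it.\<close>

definition sq_int :: "'a measure \<Rightarrow> ('a \<Rightarrow> 'b::euclidean_space) \<Rightarrow> bool" where
  "sq_int M f \<longleftrightarrow> f \<in> borel_measurable M \<and> integrable M (\<lambda>\<omega>. (norm (f \<omega>))\<^sup>2)"

lemma sq_int_measurable: "sq_int M f \<Longrightarrow> f \<in> borel_measurable M"
  by (simp add: sq_int_def)

lemma sq_int_inner:
  assumes "sq_int M f" "sq_int M g"
  shows "integrable M (\<lambda>\<omega>. f \<omega> \<bullet> g \<omega>)"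
proof (rule Bochner_Integration.integrable_bound)
  show "integrable M (\<lambda>\<omega>. (norm (f \<omega>))\<^sup>2 + (norm (g \<omega>))\<^sup>2)"
    using assms by (simp add: sq_int_def)
  show "(\<lambda>\<omega>. f \<omega> \<bullet> g \<omega>) \<in> borel_measurable M"
    using assms by (auto simp: sq_int_def intro: borel_measurable_inner)
  have "\<bar>a \<bullet> b\<bar> \<le> (norm a)\<^sup>2 + (norm b)\<^sup>2" for a b :: 'b
  proof -
    have "\<bar>a \<bullet> b\<bar> \<le> norm a * norm b"
      by (rule Cauchy_Schwarz_ineq2)
    then show ?thesis
      using sum_squares_bound[of "norm a" "norm b"] mult_nonneg_nonneg[of "norm a" "norm b"] by auto
  qed
  then show "AE \<omega> in M. norm (f \<omega> \<bullet> g \<omega>) \<le> norm ((norm (f \<omega>))\<^sup>2 + (norm (g \<omega>))\<^sup>2)"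
    by auto
qed

lemma sq_int_iff_inner: "sq_int M f \<longleftrightarrow> f \<in> borel_measurable M \<and> integrable M (\<lambda>\<omega>. f \<omega> \<bullet> f \<omega>)"
  by (simp add: sq_int_def power2_norm_eq_inner)

lemma sq_int_zero: "sq_int M (\<lambda>_. 0)"
  by (simp add: sq_int_def)

lemma sq_int_add:
  assumes "sq_int M f" "sq_int M g"
  shows "sq_int M (\<lambda>\<omega>. f \<omega> + g \<omega>)"
  unfolding sq_int_iff_inner inner_add_left inner_add_right
  using assms by (auto intro!: Bochner_Integration.integrable_add sq_int_inner borel_measurable_add
      dest: sq_int_measurable)

lemma sq_int_linear:
  assumes "sq_int M f" "bounded_linear h"
  shows "sq_int M (\<lambda>\<omega>. h (f \<omega>))"
  unfolding sq_int_def
proof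
  show meas: "(\<lambda>\<omega>. h (f \<omega>)) \<in> borel_measurable M"
    using borel_measurable_continuous_onI[OF linear_continuous_on[OF assms(2), of UNIV]]
      sq_int_measurable[OF assms(1)] by (rule measurable_compose_rev)
  obtain K where K: "\<And>v. norm (h v) \<le> norm v * K"
    using bounded_linear.bounded[OF assms(2)] by blast
  show "integrable M (\<lambda>\<omega>. (norm (h (f \<omega>)))\<^sup>2)"
  proof (rule Bochner_Integration.integrable_bound)
    show "integrable M (\<lambda>\<omega>. K\<^sup>2 * (norm (f \<omega>))\<^sup>2)"
      using assms(1) by (simp add: sq_int_def)
    show "(\<lambda>\<omega>. (norm (h (f \<omega>)))\<^sup>2) \<in> borel_measurable M"
      using meas by simp
    show "AE \<omega> in M. norm ((norm (h (f \<omega>)))\<^sup>2) \<le> norm (K\<^sup>2 * (norm (f \<omega>))\<^sup>2)"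
      using power_mono[OF K norm_ge_zero, of _ 2] by (simp add: power_mult_distrib mult.commute)
  qed
qed

lemma sq_int_diff:
  assumes "sq_int M f" "sq_int M g"
  shows "sq_int M (\<lambda>\<omega>. f \<omega> - g \<omega>)"
  using sq_int_add[OF assms(1) sq_int_linear[OF assms(2) bounded_linear_minus[OF bounded_linear_ident]]]
  by simp

lemma sq_int_sum: "(\<And>i. i \<in> I \<Longrightarrow> sq_int M (f i)) \<Longrightarrow> sq_int M (\<lambda>\<omega>. \<Sum>i\<in>I. f i \<omega>)"
  by (induction I rule: infinite_finite_induct) (auto intro: sq_int_zero sq_int_add)

lemma sq_int_matrix: "sq_int M f \<Longrightarrow> sq_int M (\<lambda>\<omega>. A *v f \<omega>)" for A :: "real^'n^'m"
  by (rule sq_int_linear) auto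

lemma sq_int_component: "sq_int M f \<Longrightarrow> sq_int M (\<lambda>\<omega>. f \<omega> $ i)" for f :: "'a \<Rightarrow> real^'n"
  by (rule sq_int_linear[OF _ bounded_linear_vec_nth])

lemma borel_measurable_vecI:
  fixes f :: "'a \<Rightarrow> real^'n"
  assumes "\<And>i. (\<lambda>\<omega>. f \<omega> $ i) \<in> borel_measurable M"
  shows "f \<in> borel_measurable M"
  using assms by (subst borel_measurable_euclidean_space) (auto simp: Basis_vec_def inner_axis)

lemma sq_int_vecI:
  fixes f :: "'a \<Rightarrow> real^'n"
  assumes "\<And>i. sq_int M (\<lambda>\<omega>. f \<omega> $ i)"
  shows "sq_int M f"
  using assms unfolding sq_int_iff_inner
  by (auto intro!: borel_measurable_vecI simp: inner_vec_def)

lemma borel_measurable_matrix: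
  fixes A :: "real^'n^'m"
  assumes "f \<in> borel_measurable M"
  shows "(\<lambda>\<omega>. A *v f \<omega>) \<in> borel_measurable M"
  using borel_measurable_continuous_onI[OF linear_continuous_on[OF matrix_vector_mul_bounded_linear, of UNIV A]]
    assms by (rule measurable_compose_rev)

lemma borel_measurable_component:
  fixes f :: "'a \<Rightarrow> real^'n"
  assumes "f \<in> borel_measurable M"
  shows "(\<lambda>\<omega>. f \<omega> $ i) \<in> borel_measurable M"
  using borel_measurable_continuous_onI[OF linear_continuous_on[OF bounded_linear_vec_nth, of UNIV i]]
    assms by (rule measurable_compose_rev)

lemma (in finite_measure) sq_int_integrable:
  assumes "sq_int M f"
  shows "integrable M f"
proof (rule Bochner_Integration.integrable_bound)
  show "integrable M (\<lambda>\<omega>. 1 + (norm (f \<omega>))\<^sup>2)"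
    using assms by (simp add: sq_int_def)
  show "f \<in> borel_measurable M"
    by (rule sq_int_measurable[OF assms])
  \<comment> \<open>Expanding \<open>0 \<le> (2 * t - 1)\<^sup>2\<close> even gives the bound 1/4 in
    place of 1.\<close>
  have "t \<le> 1 + t\<^sup>2" for t :: real
    using zero_le_power2[of "2 * t - 1"] by (simp add: power2_diff power_mult_distrib)
  then show "AE \<omega> in M. norm (f \<omega>) \<le> norm (1 + (norm (f \<omega>))\<^sup>2)"
    by simp
qed

section \<open>Factorization of measurable functions through a generating variable\<close>

lemma doob_dynkin_ennreal:
  fixes f :: "'a \<Rightarrow> ennreal"
  assumes Y: "Y \<in> X \<rightarrow> space S" and f: "f \<in> borel_measurable (vimage_algebra X Y S)"
  shows "\<exists>g\<in>borel_measurable S. \<forall>x\<in>X. f x = g (Y x)"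
  using f
proof (induction rule: borel_measurable_induct)
  case (cong f g)
  then show ?case by simp
next
  case (set A)
  then obtain A' where A': "A' \<in> sets S" "A = Y -` A' \<inter> X"
    using sets_vimage_algebra2[OF Y] by auto
  then have "\<forall>x\<in>X. indicator A x = (indicator A' (Y x) :: ennreal)"
    by (simp add: indicator_def)
  with borel_measurable_indicator[OF A'(1)] show ?case
    by blast
next
  case (mult u c)
  from mult.IH obtain g where "g \<in> borel_measurable S" "\<forall>x\<in>X. u x = g (Y x)" by blast
  then show ?case
    by (intro bexI[of _ "\<lambda>y. c * g y"]) simp_all
next
  case (add u v)
  from add.IH obtain g h where "g \<in> borel_measurable S" "\<forall>x\<in>X. u x = g (Y x)"
      "h \<in> borel_measurable S" "\<forall>x\<in>X. v x = h (Y x)" by blast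
  then show ?case
    by (intro bexI[of _ "\<lambda>y. h y + g y"]) simp_all
next
  case (seq U)
  from seq.IH obtain g where g: "\<And>i. g i \<in> borel_measurable S" "\<And>i. \<forall>x\<in>X. U i x = g i (Y x)"
    by metis
  then show ?case
    by (intro bexI[of _ "\<lambda>y. SUP i. g i y"]) (simp_all add: image_comp)
qed

text \<open>Doob-Dynkin for signed functions: positive and negative part are factored separately. It
  is what later makes a conditional expectation implementable as an updating function.\<close>

lemma doob_dynkin_real:
  fixes f :: "'a \<Rightarrow> real"
  assumes Y: "Y \<in> X \<rightarrow> space S" and f: "f \<in> borel_measurable (vimage_algebra X Y S)"
  shows "\<exists>g\<in>borel_measurable S. \<forall>x\<in>X. f x = g (Y x)"
proof -
  obtain g h where "g \<in> borel_measurable S" "\<forall>x\<in>X. ennreal (f x) = g (Y x)"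
      "h \<in> borel_measurable S" "\<forall>x\<in>X. ennreal (- f x) = h (Y x)"
    using doob_dynkin_ennreal[OF Y measurable_compose[OF f measurable_ennreal]]
      doob_dynkin_ennreal[OF Y measurable_compose[OF borel_measurable_uminus[OF f] measurable_ennreal]]
    by blast
  \<comment> \<open>\<open>ennreal\<close> sends negative reals to 0, so the two terms are the
    positive and the negative part.\<close>
  moreover have "f x = enn2real (ennreal (f x)) - enn2real (ennreal (- f x))" for x
    by (cases "f x \<ge> 0") (auto simp: ennreal_neg)
  ultimately have "\<forall>x\<in>X. f x = enn2real (g (Y x)) - enn2real (h (Y x))"
    by metis
  then show ?thesis
    using \<open>g \<in> _\<close> \<open>h \<in> _\<close>
    by (intro bexI[of _ "\<lambda>y. enn2real (g y) - enn2real (h y)"]) simp_all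
qed

section \<open>Integrals of vector- and matrix-valued functions\<close>

lemma integrable_euclideanI:
  fixes f :: "'a \<Rightarrow> 'b::euclidean_space"
  assumes "\<And>b. b \<in> Basis \<Longrightarrow> integrable M (\<lambda>\<omega>. f \<omega> \<bullet> b)"
  shows "integrable M f"
proof -
  have "integrable M (\<lambda>\<omega>. \<Sum>b\<in>Basis. (f \<omega> \<bullet> b) *\<^sub>R b)"
    by (intro Bochner_Integration.integrable_sum integrable_scaleR_left assms)
  then show ?thesis
    by (simp add: euclidean_representation)
qed

lemma integrable_matrixI:
  fixes A :: "'a \<Rightarrow> real^'n^'m"
  assumes "\<And>i j. integrable M (\<lambda>\<omega>. A \<omega> $ i $ j)"
  shows "integrable M A"
  by (rule integrable_euclideanI) (use assms in \<open>auto simp: Basis_vec_def inner_axis\<close>)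

lemma bounded_linear_matrix_component: "bounded_linear (\<lambda>A :: real^'n^'m. A $ i $ j)"
  by (rule bounded_linear_compose[OF bounded_linear_vec_nth bounded_linear_vec_nth])

lemma integral_matrix_component:
  fixes A :: "'a \<Rightarrow> real^'n^'m"
  assumes "integrable M A"
  shows "integral\<^sup>L M A $ i $ j = (\<integral>\<omega>. A \<omega> $ i $ j \<partial>M)"
  using integral_bounded_linear[OF bounded_linear_matrix_component assms, of i j]
  by simp

lemma integrable_matrix_component:
  fixes A :: "'a \<Rightarrow> real^'n^'m"
  assumes "integrable M A"
  shows "integrable M (\<lambda>\<omega>. A \<omega> $ i $ j)"
  using integrable_bounded_linear[OF bounded_linear_matrix_component assms, of i j]
  by simp

lemma inner_matrix_vec_sum:
  "v \<bullet> (A *v z) = (\<Sum>i\<in>UNIV. \<Sum>j\<in>UNIV. (v $ i * z $ j) * A $ i $ j)"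
  for A :: "real^'n^'m"
  by (simp add: inner_vec_def matrix_vector_mult_def sum_distrib_left mult_ac)

lemma sq_int_cong_AE:
  assumes "sq_int M f" "g \<in> borel_measurable M" "AE \<omega> in M. g \<omega> = f \<omega>"
  shows "sq_int M g"
proof -
  have "AE \<omega> in M. (norm (g \<omega>))\<^sup>2 = (norm (f \<omega>))\<^sup>2"
    using assms(3) by eventually_elim simp
  then show ?thesis
    using assms(1,2) unfolding sq_int_def
    by (subst integrable_cong_AE[where g="\<lambda>\<omega>. (norm (f \<omega>))\<^sup>2"]) auto
qed

text \<open>With mean zero the centred outer product is
  \<open>outer (X \<omega>) (X \<omega>)\<close>, whose trace is the squared norm.\<close>

lemma has_covariance_sq_int:
  fixes X :: "'a \<Rightarrow> real^'n"
  assumes "has_covariance M X S" "integral\<^sup>L M X = 0"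
  shows "sq_int M X"
proof -
  have X: "integrable M X" "integrable M (\<lambda>\<omega>. outer (X \<omega>) (X \<omega>))"
    using assms by (simp_all add: has_covariance_def Let_def)
  have "integrable M (\<lambda>\<omega>. \<Sum>i\<in>UNIV. outer (X \<omega>) (X \<omega>) $ i $ i)"
    by (intro Bochner_Integration.integrable_sum integrable_matrix_component X)
  moreover have "(\<Sum>i\<in>UNIV. outer (X \<omega>) (X \<omega>) $ i $ i) = X \<omega> \<bullet> X \<omega>" for \<omega>
    by (simp add: outer_def inner_vec_def)
  ultimately show ?thesis
    using X(1) by (simp add: sq_int_iff_inner borel_measurable_integrable)
qed

section \<open>Generated algebras and measurability of the learning machine\<close>

lemma sets_vimage_algebra_subset:
  assumes "Y \<in> measurable H S"
  shows "sets (vimage_algebra (space H) Y S) \<subseteq> sets H"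
proof -
  have "Y \<in> space H \<rightarrow> space S"
    using measurable_space[OF assms] by auto
  then show ?thesis
    using measurable_sets[OF assms] by (auto simp: sets_vimage_algebra2)
qed

text \<open>Both sides carry the zero measure, so equal sets suffice. Equality as measures permits
  rewriting inside a conditional expectation.\<close>

lemma vimage_algebra_eqI:
  assumes "sets (vimage_algebra X Y S) = sets (vimage_algebra X Y' S')"
  shows "vimage_algebra X Y S = vimage_algebra X Y' S'"
  using assms by (rule measure_eqI) (simp add: vimage_algebra_def emeasure_sigma)

lemma outcome_measurable:
  fixes w :: "'a \<Rightarrow> real^'d::finite"
  assumes "w \<in> borel_measurable H" "x k \<in> borel_measurable H" "eps k \<in> borel_measurable H"
  shows "outcome w x eps k \<in> borel_measurable H"
  using borel_measurable_add[OF borel_measurable_inner[OF assms(1,2)] assms(3)]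
  by (simp add: outcome_def[abs_def])

text \<open>Strong induction, as an update depends on all earlier ones through the information
  vector. \<open>H\<close> is arbitrary so that one induction serves the full algebra, the observed
  data and the past.\<close>

lemma update_measurable:
  fixes w :: "'a \<Rightarrow> real^'d::finite"
  assumes u: "u \<in> updating_functions N"
    and "k < N"
    and "\<And>j. j \<le> k \<Longrightarrow> x j \<in> borel_measurable H"
    and "\<And>j. j \<le> k \<Longrightarrow> outcome w x eps j \<in> borel_measurable H"
  shows "update w x eps u k \<in> borel_measurable H"
  using assms(2-)
proof (induction k rule: less_induct)
  case (less k)
  have 1: "(\<lambda>\<omega>. \<lambda>j\<in>{..<k}. update w x eps u j \<omega>) \<in> measurable H (PiM {..<k} (\<lambda>_. borel))"
    using less.prems by (intro measurable_restrict less.IH) auto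
  have 2: "(\<lambda>\<omega>. \<lambda>j\<in>{..k}. (x j \<omega>, outcome w x eps j \<omega>)) \<in> measurable H (PiM {..k} (\<lambda>_. borel))"
    using less.prems by (intro measurable_restrict borel_measurable_Pair) auto
  have "info w x eps u k \<in> measurable H (info_space k)"
    unfolding info_def[abs_def] info_space_def by (rule measurable_Pair[OF 2 1])
  moreover have "u k \<in> borel_measurable (info_space k)"
    using u less.prems(1) by (simp add: updating_functions_def)
  ultimately have "(\<lambda>\<omega>. u k (info w x eps u k \<omega>)) \<in> borel_measurable H"
    by (rule measurable_compose)
  moreover have "update w x eps u k = (\<lambda>\<omega>. u k (info w x eps u k \<omega>))"
    by (rule ext) (rule update_info)
  ultimately show ?case
    by simp
qed

text \<open>Only data strictly before \<open>k\<close> enter. This strictness is what later makes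
  the error at time \<open>k\<close> independent of \<open>x k\<close>.\<close>

lemma estimate_measurable:
  fixes w :: "'a \<Rightarrow> real^'d::finite"
  assumes "u \<in> updating_functions N" "k \<le> N"
    and "\<And>j. j < k \<Longrightarrow> x j \<in> borel_measurable H"
    and "\<And>j. j < k \<Longrightarrow> outcome w x eps j \<in> borel_measurable H"
  shows "estimate w x eps u k \<in> borel_measurable H"
proof -
  have "(\<lambda>\<omega>. \<Sum>j<k. update w x eps u j \<omega>) \<in> borel_measurable H"
    using assms by (intro borel_measurable_sum update_measurable[OF assms(1)]) auto
  then show ?thesis
    by (simp add: estimate_eq_sum[abs_def])
qed

text \<open>The pi-system property under which groups of independent families generate independent
  sigma-algebras.\<close>

lemma Int_stable_preimages: "Int_stable (preimages M X)"
proof (rule Int_stableI)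
  fix a b assume "a \<in> preimages M X" "b \<in> preimages M X"
  then obtain A B where "A \<in> sets borel" "a = X -` A \<inter> space M" "B \<in> sets borel" "b = X -` B \<inter> space M"
    by (auto simp: preimages_def)
  then show "a \<inter> b \<in> preimages M X"
    unfolding preimages_def by (intro CollectI exI[of _ "A \<inter> B"]) auto
qed

section \<open>Independence of past and present\<close>

locale online_learning = prob_space M
  for M :: "'a measure" +
  fixes w :: "'a \<Rightarrow> real^'d::finite"
    and x :: "nat \<Rightarrow> 'a \<Rightarrow> real^'d"
    and eps :: "nat \<Rightarrow> 'a \<Rightarrow> real"
    and \<gamma> :: real
    and N :: nat
  assumes indep: "mutually_independent M w x eps"
    and w_sq: "sq_int M w"
    and x_sq: "sq_int M (x k)"
    and eps_measurable: "eps k \<in> borel_measurable M"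
    and \<gamma>_pos: "\<gamma> > 0"
begin

definition source_events :: "source \<Rightarrow> 'a set set" where
  "source_events s = (case s of Param \<Rightarrow> preimages M w | Input k \<Rightarrow> preimages M (x k)
     | Noise k \<Rightarrow> preimages M (eps k))"

text \<open>The unobserved parameter counts as past, because the errors depend on it.\<close>

definition past_sources :: "nat \<Rightarrow> source set" where
  "past_sources k = insert Param (Input ` {..<k} \<union> Noise ` {..<k})"

definition past :: "nat \<Rightarrow> 'a measure" where
  "past k = sigma (space M) (\<Union>s\<in>past_sources k. source_events s)"

lemma source_events_into_space: "source_events s \<subseteq> Pow (space M)"
  by (auto simp: source_events_def preimages_def split: source.splits)

lemma sets_past: "sets (past k) = sigma_sets (space M) (\<Union>s\<in>past_sources k. source_events s)"
  unfolding past_def using source_events_into_space by (subst sets_measure_of) auto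

lemma space_past: "space (past k) = space M"
  unfolding past_def by (subst space_measure_of) (use source_events_into_space in auto)

lemma measurable_pastI:
  assumes "s \<in> past_sources k" "source_events s = preimages M X"
  shows "X \<in> borel_measurable (past k)"
proof (rule measurableI)
  fix A :: "'b set" assume "A \<in> sets borel"
  then have "X -` A \<inter> space M \<in> source_events s"
    using assms(2) by (auto simp: preimages_def)
  then show "X -` A \<inter> space (past k) \<in> sets (past k)"
    unfolding sets_past space_past using assms(1) by (auto intro: sigma_sets.Basic)
qed auto

lemma past_measurable:
  "w \<in> borel_measurable (past k)"
  "j < k \<Longrightarrow> x j \<in> borel_measurable (past k)"
  "j < k \<Longrightarrow> outcome w x eps j \<in> borel_measurable (past k)"
proof -
  show w: "w \<in> borel_measurable (past k)"
    by (rule measurable_pastI[of Param]) (auto simp: past_sources_def source_events_def)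
  have x: "x j \<in> borel_measurable (past k)" if "j < k" for j
    by (rule measurable_pastI[of "Input j"]) (use that in \<open>auto simp: past_sources_def source_events_def\<close>)
  have eps: "eps j \<in> borel_measurable (past k)" if "j < k" for j
    by (rule measurable_pastI[of "Noise j"]) (use that in \<open>auto simp: past_sources_def source_events_def\<close>)
  show "j < k \<Longrightarrow> x j \<in> borel_measurable (past k)"
    and "j < k \<Longrightarrow> outcome w x eps j \<in> borel_measurable (past k)"
    by (auto intro!: outcome_measurable w x eps)
qed

lemma Int_stable_source_events: "Int_stable (source_events s)"
  by (auto simp: source_events_def Int_stable_preimages split: source.split)

text \<open>\<open>Input k\<close> is not a past source, so the two groups are disjoint subfamilies
  of an independent family and generate independent sigma-algebras. Each of the two variables is
  measurable for one of them.\<close>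

lemma indep_past_input:
  fixes f :: "'a \<Rightarrow> 'b::topological_space" and h :: "real^'d \<Rightarrow> 'b"
  assumes f: "f \<in> borel_measurable (past k)" "f \<in> borel_measurable M"
    and h: "h \<in> borel_measurable borel"
  shows "indep_var borel f borel (\<lambda>\<omega>. h (x k \<omega>))"
proof -
  let ?I = "case_bool (past_sources k) {Input k}"
  have "indep_sets source_events UNIV"
    using indep by (simp add: mutually_independent_def source_events_def[abs_def])
  then have "indep_sets (\<lambda>b. sigma_sets (space M) (\<Union>s\<in>?I b. source_events s)) UNIV"
    by (intro indep_sets_collect_sigma Int_stable_source_events)
      (auto intro: indep_sets_mono_index simp: disjoint_family_on_def past_sources_def split: bool.splits)
  moreover have "sigma_sets (space M) {f -` A \<inter> space M |A. A \<in> sets borel} \<subseteq>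
      sigma_sets (space M) (\<Union>s\<in>past_sources k. source_events s)"
    using measurable_sets[OF f(1)] by (intro sigma_sets_mono) (auto simp: sets_past space_past)
  moreover have "sigma_sets (space M) {(\<lambda>\<omega>. h (x k \<omega>)) -` A \<inter> space M |A. A \<in> sets borel} \<subseteq>
      sigma_sets (space M) (source_events (Input k))"
  proof (rule sigma_sets_mono, safe)
    fix A :: "'b set" assume "A \<in> sets borel"
    then have "h -` A \<in> sets borel"
      using measurable_sets[OF h] by simp
    moreover have "(\<lambda>\<omega>. h (x k \<omega>)) -` A \<inter> space M = x k -` (h -` A) \<inter> space M"
      by auto
    ultimately show "(\<lambda>\<omega>. h (x k \<omega>)) -` A \<inter> space M \<in> sigma_sets (space M) (source_events (Input k))"
      by (intro sigma_sets.Basic) (auto simp: source_events_def preimages_def)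
  qed
  ultimately have "indep_sets (case_bool
      (sigma_sets (space M) {f -` A \<inter> space M |A. A \<in> sets borel})
      (sigma_sets (space M) {(\<lambda>\<omega>. h (x k \<omega>)) -` A \<inter> space M |A. A \<in> sets borel})) UNIV"
    by (elim indep_sets_mono_sets) (auto split: bool.split)
  then show ?thesis
    unfolding indep_var_eq indep_set_def
    using f(2) measurable_compose[OF sq_int_measurable[OF x_sq] h] by auto
qed

section \<open>Replacing \<open>Qmat x k\<close> by its mean\<close>

abbreviation EQ :: "nat \<Rightarrow> real^'d^'d" where
  "EQ k \<equiv> integral\<^sup>L M (Qmat x k)"

lemma Qmat_component: "Qmat x k \<omega> $ i $ j = x k \<omega> $ i * x k \<omega> $ j"
  by (simp add: Qmat_def outer_def)

lemma integrable_Qmat: "integrable M (Qmat x k)"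
proof (rule integrable_matrixI)
  fix i j
  show "integrable M (\<lambda>\<omega>. Qmat x k \<omega> $ i $ j)"
    using sq_int_inner[OF sq_int_component[OF x_sq, of k i] sq_int_component[OF x_sq, of k j]]
    by (simp add: Qmat_component)
qed

text \<open>Entrywise the form is a sum of products of the independent factors
  \<open>e \<omega> $ i * e \<omega> $ j\<close> and \<open>Qmat x k \<omega> $ i $ j\<close>.
  Independence also gives integrability of these products, without fourth moments.\<close>

lemma
  assumes e: "e \<in> borel_measurable (past k)" "sq_int M e"
  shows integrable_past_quadratic: "integrable M (\<lambda>\<omega>. e \<omega> \<bullet> (Qmat x k \<omega> *v e \<omega>))"
    and integral_past_quadratic:
      "(\<integral>\<omega>. e \<omega> \<bullet> (Qmat x k \<omega> *v e \<omega>) \<partial>M) = (\<integral>\<omega>. e \<omega> \<bullet> (EQ k *v e \<omega>) \<partial>M)"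
proof -
  have ee: "integrable M (\<lambda>\<omega>. e \<omega> $ i * e \<omega> $ j)" for i j
    using sq_int_inner[OF sq_int_component[OF e(2), of i] sq_int_component[OF e(2), of j]] by simp
  have Q: "integrable M (\<lambda>\<omega>. Qmat x k \<omega> $ i $ j)" for i j
    by (rule integrable_matrix_component[OF integrable_Qmat])
  have ind: "indep_var borel (\<lambda>\<omega>. e \<omega> $ i * e \<omega> $ j) borel (\<lambda>\<omega>. Qmat x k \<omega> $ i $ j)" for i j
    unfolding Qmat_component
    by (rule indep_past_input[where h="\<lambda>v. v $ i * v $ j"])
      (use e sq_int_measurable[OF e(2)] in
        \<open>auto intro!: borel_measurable_times borel_measurable_component\<close>)
  note int = indep_var_integrable[OF ind ee Q]
  show "integrable M (\<lambda>\<omega>. e \<omega> \<bullet> (Qmat x k \<omega> *v e \<omega>))"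
    unfolding inner_matrix_vec_sum by (intro Bochner_Integration.integrable_sum int)
  show "(\<integral>\<omega>. e \<omega> \<bullet> (Qmat x k \<omega> *v e \<omega>) \<partial>M) = (\<integral>\<omega>. e \<omega> \<bullet> (EQ k *v e \<omega>) \<partial>M)"
    unfolding inner_matrix_vec_sum
    by (simp add: int ee indep_var_lebesgue_integral[OF ind ee Q]
        integral_matrix_component[OF integrable_Qmat])
qed

text \<open>The information vector without its updates, hence an object in which no policy
  occurs.\<close>

definition obs :: "nat \<Rightarrow> 'a \<Rightarrow> nat \<Rightarrow> (real^'d) \<times> real" where
  "obs k \<omega> = (\<lambda>j\<in>{..k}. (x j \<omega>, outcome w x eps j \<omega>))"

definition G :: "nat \<Rightarrow> 'a measure" where
  "G k = vimage_algebra (space M) (obs k) (PiM {..k} (\<lambda>_. borel))"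

lemma space_G: "space (G k) = space M"
  by (simp add: G_def)

lemma data_measurable:
  "w \<in> borel_measurable M" "x k \<in> borel_measurable M" "outcome w x eps k \<in> borel_measurable M"
  using sq_int_measurable[OF w_sq] sq_int_measurable[OF x_sq] eps_measurable
  by (auto intro: outcome_measurable)

lemma obs_measurable:
  assumes "\<And>j. j \<le> k \<Longrightarrow> x j \<in> borel_measurable H"
    and "\<And>j. j \<le> k \<Longrightarrow> outcome w x eps j \<in> borel_measurable H"
  shows "obs k \<in> measurable H (PiM {..k} (\<lambda>_. borel))"
  unfolding obs_def[abs_def] using assms by (intro measurable_restrict borel_measurable_Pair) auto

lemma obs_measurable_M: "obs k \<in> measurable M (PiM {..k} (\<lambda>_. borel))"
  by (intro obs_measurable data_measurable)

lemma obs_funcset: "obs k \<in> space M \<rightarrow> space (PiM {..k} (\<lambda>_. borel))"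
  using measurable_space[OF obs_measurable_M] by auto

lemma subalgebra_G: "subalgebra M (G k)"
  unfolding subalgebra_def using sets_vimage_algebra_subset[OF obs_measurable_M]
  by (simp add: G_def)

lemma G_measurable:
  assumes "j \<le> k"
  shows "x j \<in> borel_measurable (G k)" "outcome w x eps j \<in> borel_measurable (G k)"
proof -
  have "obs k \<in> measurable (G k) (PiM {..k} (\<lambda>_. borel))"
    unfolding G_def by (rule measurable_vimage_algebra1[OF obs_funcset])
  from measurable_compose[OF this measurable_component_singleton[of j]]
  have "(\<lambda>\<omega>. obs k \<omega> j) \<in> borel_measurable (G k)"
    using assms by simp
  from measurable_compose[OF this borel_measurable_continuous_onI[OF continuous_on_fst[OF continuous_on_id]]]
    measurable_compose[OF this borel_measurable_continuous_onI[OF continuous_on_snd[OF continuous_on_id]]]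
  show "x j \<in> borel_measurable (G k)" "outcome w x eps j \<in> borel_measurable (G k)"
    using assms by (simp_all add: obs_def)
qed

text \<open>The updates are functions of the observed data, so \<open>\<tilde>I\<^sub>k\<close> generates the same
  \<open>\<sigma>\<close>-algebra under every policy.\<close>

lemma tilde_info_algebra:
  assumes u: "u \<in> updating_functions N" and k: "k < N"
  shows "vimage_algebra (space M) (tilde_info w x eps u k) (info_space k) = G k"
proof -
  have outcome_err: "outcome_err w x eps u j \<in> borel_measurable (G k)" if "j \<le> k" for j
  proof -
    have "estimate w x eps u j \<in> borel_measurable (G k)"
      using that k by (intro estimate_measurable[OF u] G_measurable) auto
    then show ?thesis
      unfolding outcome_err_def[abs_def] using that
      by (intro borel_measurable_diff borel_measurable_inner G_measurable)
  qed
  have "update w x eps u j \<in> borel_measurable (G k)" if "j < k" for j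
    using that k by (intro update_measurable[OF u] G_measurable) auto
  then have Z: "tilde_info w x eps u k \<in> measurable (G k) (info_space k)"
    unfolding tilde_info_def[abs_def] info_space_def
    by (intro measurable_Pair measurable_restrict borel_measurable_Pair G_measurable outcome_err) auto
  \<comment> \<open>For the converse inclusion the observed data are recovered from the transformed
    information vector.\<close>
  let ?V = "vimage_algebra (space M) (tilde_info w x eps u k) (info_space k)"
  have ZV: "tilde_info w x eps u k \<in> measurable ?V (info_space k)"
    using measurable_space[OF Z] by (intro measurable_vimage_algebra1) (auto simp: space_G)
  have ZV': "tilde_info w x eps u k \<in> measurable ?V (PiM {..k} (\<lambda>_. borel) \<Otimes>\<^sub>M PiM {..<k} (\<lambda>_. borel))"
    using ZV unfolding info_space_def .
  have xy: "(\<lambda>\<omega>. (x j \<omega>, outcome_err w x eps u j \<omega>)) \<in> borel_measurable ?V" if "j \<le> k" for j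
    using measurable_compose[OF measurable_compose[OF ZV' measurable_fst]
        measurable_component_singleton[of j]] that
    by (simp add: tilde_info_def)
  have x: "x j \<in> borel_measurable ?V" and o: "outcome_err w x eps u j \<in> borel_measurable ?V"
    if "j \<le> k" for j
    using measurable_compose[OF xy[OF that] borel_measurable_continuous_onI[OF continuous_on_fst[OF continuous_on_id]]]
      measurable_compose[OF xy[OF that] borel_measurable_continuous_onI[OF continuous_on_snd[OF continuous_on_id]]]
    by simp_all
  have us: "update w x eps u j \<in> borel_measurable ?V" if "j < k" for j
    using measurable_compose[OF measurable_compose[OF ZV' measurable_snd]
        measurable_component_singleton[of j]] that
    by (simp add: tilde_info_def)
  \<comment> \<open>The past updates determine the estimate, which undoes the passage from outcome
    to outcome error.\<close>
  have outcome_eq: "outcome w x eps j = (\<lambda>\<omega>. (\<Sum>i<j. update w x eps u i \<omega>) \<bullet> x j \<omega> - outcome_err w x eps u j \<omega>)" for j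
    by (simp add: outcome_err_def estimate_eq_sum fun_eq_iff)
  have "outcome w x eps j \<in> borel_measurable ?V" if "j \<le> k" for j
    unfolding outcome_eq using that
    by (intro borel_measurable_diff borel_measurable_inner borel_measurable_sum us x o) auto
  then have "obs k \<in> measurable ?V (PiM {..k} (\<lambda>_. borel))"
    by (intro obs_measurable x)
  from sets_vimage_algebra_subset[OF this] sets_vimage_algebra_subset[OF Z] show ?thesis
    unfolding G_def by (intro vimage_algebra_eqI) auto
qed

section \<open>Estimation of the parameter\<close>

definition What :: "nat \<Rightarrow> 'a \<Rightarrow> real^'d" where
  "What k \<omega> = (\<chi> i. real_cond_exp M (G k) (\<lambda>\<omega>'. w \<omega>' $ i) \<omega>)"

lemma sigma_finite_G: "sigma_finite_subalgebra M (G k)"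
  by (intro finite_measure_subalgebra_is_sigma_finite finite_measure_subalgebra.intro
      finite_measure_subalgebra_axioms.intro subalgebra_G finite_measure_axioms)

lemma What_measurable: "What k \<in> borel_measurable (G k)"
  by (rule borel_measurable_vecI) (simp add: What_def)

lemma measurable_from_G: "f \<in> borel_measurable (G k) \<Longrightarrow> f \<in> borel_measurable M"
  by (rule measurable_from_subalg[OF subalgebra_G])

lemma integrable_w_component: "integrable M (\<lambda>\<omega>. w \<omega> $ i)"
  by (rule sq_int_integrable[OF sq_int_component[OF w_sq]])

text \<open>By conditional Jensen, the squared conditional expectation is dominated by the
  conditional expectation of the square, which is integrable.\<close>

lemma What_sq: "sq_int M (What k)"
proof (rule sq_int_vecI)
  fix i
  interpret sigma_finite_subalgebra M "G k" by (rule sigma_finite_G)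
  have w2: "integrable M (\<lambda>\<omega>. (w \<omega> $ i)\<^sup>2)"
    using sq_int_component[OF w_sq] by (simp add: sq_int_def)
  have cvx: "convex_on UNIV (\<lambda>t::real. t\<^sup>2)"
    by (rule convex_power2)
  have jensen: "AE \<omega> in M. (real_cond_exp M (G k) (\<lambda>\<omega>. w \<omega> $ i) \<omega>)\<^sup>2 \<le>
      real_cond_exp M (G k) (\<lambda>\<omega>. (w \<omega> $ i)\<^sup>2) \<omega>"
    by (rule real_cond_exp_jensens_inequality(2)[where I=UNIV and q="\<lambda>t. t\<^sup>2"])
      (use integrable_w_component w2 cvx in auto)
  have meas: "(\<lambda>\<omega>. real_cond_exp M (G k) (\<lambda>\<omega>. w \<omega> $ i) \<omega>) \<in> borel_measurable M"
    by (rule measurable_from_G[of _ k]) simp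
  have "integrable M (\<lambda>\<omega>. (real_cond_exp M (G k) (\<lambda>\<omega>. w \<omega> $ i) \<omega>)\<^sup>2)"
  proof (rule Bochner_Integration.integrable_bound[OF real_cond_exp_int(1)[OF w2]])
    show "(\<lambda>\<omega>. (real_cond_exp M (G k) (\<lambda>\<omega>. w \<omega> $ i) \<omega>)\<^sup>2) \<in> borel_measurable M"
      using meas by simp
    show "AE \<omega> in M. norm ((real_cond_exp M (G k) (\<lambda>\<omega>. w \<omega> $ i) \<omega>)\<^sup>2) \<le>
        norm (real_cond_exp M (G k) (\<lambda>\<omega>. (w \<omega> $ i)\<^sup>2) \<omega>)"
      using jensen by eventually_elim auto
  qed
  then show "sq_int M (\<lambda>\<omega>. What k \<omega> $ i)"
    using meas by (simp add: sq_int_def What_def)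
qed

text \<open>Conditional expectation acts as an orthogonal projection: an observable factor may be
  moved through it, componentwise. Square-integrability makes the products integrable.\<close>

lemma integral_residual_orthogonal:
  assumes a: "a \<in> borel_measurable (G k)" "sq_int M a"
  shows "(\<integral>\<omega>. a \<omega> \<bullet> (w \<omega> - What k \<omega>) \<partial>M) = 0"
proof -
  interpret sigma_finite_subalgebra M "G k" by (rule sigma_finite_G)
  have aw: "integrable M (\<lambda>\<omega>. a \<omega> $ i * w \<omega> $ i)" for i
    using sq_int_inner[OF sq_int_component[OF a(2)] sq_int_component[OF w_sq]] by simp
  have aW: "integrable M (\<lambda>\<omega>. a \<omega> $ i * What k \<omega> $ i)" for i
    using sq_int_inner[OF sq_int_component[OF a(2)] sq_int_component[OF What_sq]] by simp
  have "(\<integral>\<omega>. a \<omega> $ i * What k \<omega> $ i \<partial>M) = (\<integral>\<omega>. a \<omega> $ i * w \<omega> $ i \<partial>M)" for i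
    unfolding What_def vec_lambda_beta
    by (rule real_cond_exp_intg(2)[OF aw])
      (auto intro: borel_measurable_component a(1) borel_measurable_integrable integrable_w_component)
  then show ?thesis
    by (simp add: inner_vec_def right_diff_distrib aw aW)
qed

text \<open>Pythagoras in the \<open>S\<close>-form: the cross term is the residual paired with an
  observable vector, so its mean is zero.\<close>

lemma integral_residual_split:
  fixes S :: "real^'d^'d"
  assumes a: "a \<in> borel_measurable (G k)" "sq_int M a" and S: "transpose S = S"
  defines "r \<equiv> \<lambda>\<omega>. w \<omega> - What k \<omega>"
  shows "(\<integral>\<omega>. (a \<omega> + L *v r \<omega>) \<bullet> (S *v (a \<omega> + L *v r \<omega>)) \<partial>M) =
    (\<integral>\<omega>. a \<omega> \<bullet> (S *v a \<omega>) \<partial>M) + (\<integral>\<omega>. (L *v r \<omega>) \<bullet> (S *v (L *v r \<omega>)) \<partial>M)"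
proof -
  \<comment> \<open>By symmetry of \<open>S\<close>, this is the factor of \<open>r\<close> in the
    cross term.\<close>
  define b where "b \<omega> = transpose L *v (S *v a \<omega>)" for \<omega>
  have b: "b \<in> borel_measurable (G k)" "sq_int M b"
    unfolding b_def by (intro borel_measurable_matrix a sq_int_matrix)+
  have r: "sq_int M r"
    unfolding r_def by (intro sq_int_diff w_sq What_sq)
  have "(a \<omega> + L *v r \<omega>) \<bullet> (S *v (a \<omega> + L *v r \<omega>)) =
      a \<omega> \<bullet> (S *v a \<omega>) + (L *v r \<omega>) \<bullet> (S *v (L *v r \<omega>)) + 2 * (b \<omega> \<bullet> r \<omega>)" for \<omega>
  proof -
    have "b \<omega> \<bullet> r \<omega> = (S *v a \<omega>) \<bullet> (L *v r \<omega>)"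
      by (simp add: b_def dot_lmul_matrix)
    moreover have "a \<omega> \<bullet> (S *v (L *v r \<omega>)) = (S *v a \<omega>) \<bullet> (L *v r \<omega>)"
      by (rule symmetric_inner_matrix[OF S])
    ultimately show ?thesis
      by (simp add: matrix_vector_right_distrib inner_add_left inner_add_right inner_commute)
  qed
  moreover have "(\<integral>\<omega>. b \<omega> \<bullet> r \<omega> \<partial>M) = 0"
    unfolding r_def by (rule integral_residual_orthogonal[OF b])
  ultimately show ?thesis
    by (simp add: sq_int_inner sq_int_matrix a(2) r b(2))
qed

text \<open>An observable vector is its own conditional expectation, so linearity leaves only that
  of \<open>w\<close>. With the estimate as \<open>b\<close>, this computes the conditional mean of
  the error.\<close>

lemma cond_exp_shifted_parameter:
  assumes b: "b \<in> borel_measurable (G k)" "sq_int M b"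
  shows "AE \<omega> in M. (\<chi> i. real_cond_exp M (G k) (\<lambda>\<omega>'. (b \<omega>' - w \<omega>') $ i) \<omega>) = b \<omega> - What k \<omega>"
proof -
  interpret sigma_finite_subalgebra M "G k" by (rule sigma_finite_G)
  have bi: "integrable M (\<lambda>\<omega>. b \<omega> $ i)" for i
    by (rule sq_int_integrable[OF sq_int_component[OF b(2)]])
  have "AE \<omega> in M. real_cond_exp M (G k) (\<lambda>\<omega>'. (b \<omega>' - w \<omega>') $ i) \<omega> = (b \<omega> - What k \<omega>) $ i" for i
    using real_cond_exp_diff[OF bi[of i] integrable_w_component[of i]]
      real_cond_exp_F_meas[OF bi[of i] borel_measurable_component[OF b(1)]]
    by eventually_elim (simp add: What_def)
  \<comment> \<open>There are only finitely many components, so their null sets unite to a null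
    set.\<close>
  then have "AE \<omega> in M. \<forall>i. real_cond_exp M (G k) (\<lambda>\<omega>'. (b \<omega>' - w \<omega>') $ i) \<omega> = (b \<omega> - What k \<omega>) $ i"
    by (simp add: AE_all_countable)
  then show ?thesis
    by eventually_elim (simp add: vec_eq_iff)
qed

section \<open>Dynamic programming\<close>

abbreviation K :: "nat \<Rightarrow> real^'d^'d" where
  "K \<equiv> Kbar M x \<gamma> N"

abbreviation L :: "nat \<Rightarrow> real^'d^'d" where
  "L \<equiv> Lmat M x \<gamma> N"

abbreviation F :: "nat \<Rightarrow> real^'d^'d" where
  "F \<equiv> Fmat M x \<gamma> N"

abbreviation S :: "nat \<Rightarrow> real^'d^'d" where
  "S k \<equiv> K (Suc k) + \<gamma> *\<^sub>R mat 1"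

lemma sym_psd_EQ: "sym_psd (EQ k)"
proof -
  have "transpose (EQ k) = EQ k"
    by (simp add: transpose_def vec_eq_iff integral_matrix_component[OF integrable_Qmat]
        Qmat_component mult.commute)
  moreover have "0 \<le> v \<bullet> (EQ k *v v)" for v
  proof -
    \<comment> \<open>A constant vector is an admissible error in
      \<open>integral_past_quadratic\<close>, which exchanges expectation and form.\<close>
    have "sq_int M (\<lambda>_. v)"
      by (simp add: sq_int_def)
    from integral_past_quadratic[OF _ this, of k]
    have "v \<bullet> (EQ k *v v) = (\<integral>\<omega>. v \<bullet> (Qmat x k \<omega> *v v) \<partial>M)"
      by (simp add: prob_space)
    then show ?thesis
      by (simp add: Qmat_def inner_outer_self)
  qed
  ultimately show ?thesis
    by (simp add: sym_psd_def)
qed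

lemma K_N: "K N = EQ N"
  by (simp add: Kbar_def Defs.K_N)

text \<open>In \<open>Kmat\<close> only the summand \<open>Qmat x k\<close> is random, so the
  expectation acts on it alone.\<close>

lemma K_step:
  assumes "k < N"
  shows "K k = K (Suc k) - F k + EQ k"
proof -
  have "Kmat M x \<gamma> N k = (\<lambda>\<omega>. (K (Suc k) - F k) + Qmat x k \<omega>)"
    using assms by (simp add: fun_eq_iff Defs.K_step Fmat_def)
  then have "K k = (\<integral>\<omega>. (K (Suc k) - F k) + Qmat x k \<omega> \<partial>M)"
    by (simp add: Kbar_def)
  also have "\<dots> = K (Suc k) - F k + EQ k"
    by (subst Bochner_Integration.integral_add) (auto simp: integrable_Qmat prob_space)
  finally show ?thesis .
qed

text \<open>Downward induction from \<open>N\<close>: each step adds \<open>EQ k\<close> to the form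
  of a minimal one-step cost.\<close>

lemma sym_psd_K: "k \<le> N \<Longrightarrow> sym_psd (K k)"
proof (induction k rule: inc_induct)
  case base
  then show ?case by (simp add: K_N sym_psd_EQ)
next
  case (step k)
  then show ?case
    using sym_psd_add[OF sym_psd_diff_correction[OF step.IH \<gamma>_pos] sym_psd_EQ[of k]]
    by (simp add: K_step Fmat_def)
qed

lemma sym_psd_Kmat: "k \<le> N \<Longrightarrow> sym_psd (Kmat M x \<gamma> N k \<omega>)"
proof (cases "k = N")
  case True
  then show ?thesis by (simp add: Defs.K_N Qmat_def sym_psd_outer)
next
  case False
  moreover assume "k \<le> N"
  ultimately have "k < N" by simp
  then show ?thesis
    using sym_psd_add[OF sym_psd_diff_correction[OF sym_psd_K[of "Suc k"] \<gamma>_pos] sym_psd_outer[of "x k \<omega>"]]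
    by (simp add: Defs.K_step Qmat_def)
qed

section \<open>Errors, updates and cost under a fixed policy\<close>

abbreviation upd where "upd \<equiv> update w x eps"
abbreviation est where "est \<equiv> estimate w x eps"
abbreviation er where "er \<equiv> err w x eps"

lemma
  assumes "u \<in> updating_functions N"
  shows upd_measurable: "k < N \<Longrightarrow> upd u k \<in> borel_measurable M"
    and upd_G: "k < N \<Longrightarrow> upd u k \<in> borel_measurable (G k)"
    and est_G: "k < N \<Longrightarrow> est u k \<in> borel_measurable (G k)"
    and er_past: "k \<le> N \<Longrightarrow> er u k \<in> borel_measurable (past k)"
    and er_measurable: "k \<le> N \<Longrightarrow> er u k \<in> borel_measurable M"
proof -
  show "k < N \<Longrightarrow> upd u k \<in> borel_measurable M"
    by (intro update_measurable[OF assms] data_measurable)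
  show "k < N \<Longrightarrow> upd u k \<in> borel_measurable (G k)"
    by (intro update_measurable[OF assms] G_measurable)
  show "k < N \<Longrightarrow> est u k \<in> borel_measurable (G k)"
    by (intro estimate_measurable[OF assms] G_measurable) auto
  show "k \<le> N \<Longrightarrow> er u k \<in> borel_measurable (past k)"
    unfolding err_def[abs_def]
    by (intro borel_measurable_diff estimate_measurable[OF assms] past_measurable)
  show "k \<le> N \<Longrightarrow> er u k \<in> borel_measurable M"
    unfolding err_def[abs_def]
    by (intro borel_measurable_diff estimate_measurable[OF assms] data_measurable)
qed

lemma est_sq: "(\<And>j. j < k \<Longrightarrow> sq_int M (upd u j)) \<Longrightarrow> sq_int M (est u k)"
  unfolding estimate_eq_sum[abs_def] by (rule sq_int_sum) auto

lemma er_sq: "(\<And>j. j < k \<Longrightarrow> sq_int M (upd u j)) \<Longrightarrow> sq_int M (er u k)"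
  unfolding err_def[abs_def] by (intro sq_int_diff est_sq w_sq)

definition stage_cost :: "'d policy \<Rightarrow> nat \<Rightarrow> 'a \<Rightarrow> real" where
  "stage_cost u k \<omega> = er u k \<omega> \<bullet> (Qmat x k \<omega> *v er u k \<omega>) + \<gamma> * (upd u k \<omega> \<bullet> upd u k \<omega>)"

definition cost :: "'d policy \<Rightarrow> 'a \<Rightarrow> real" where
  "cost u \<omega> = (\<Sum>k<N. stage_cost u k \<omega>) + er u N \<omega> \<bullet> (Qmat x N \<omega> *v er u N \<omega>)"

lemma learning_functional_eq: "learning_functional w x eps u M \<gamma> N = (\<integral>\<^sup>+ \<omega>. ennreal (cost u \<omega>) \<partial>M)"
  by (simp add: learning_functional_def cost_def stage_cost_def)

lemma stage_cost_ge: "\<gamma> * (upd u k \<omega> \<bullet> upd u k \<omega>) \<le> stage_cost u k \<omega>"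
  by (simp add: stage_cost_def Qmat_def inner_outer_self)

lemma stage_cost_nonneg: "0 \<le> stage_cost u k \<omega>"
  using \<gamma>_pos by (intro order_trans[OF _ stage_cost_ge]) simp

lemma cost_ge_stage: "k < N \<Longrightarrow> stage_cost u k \<omega> \<le> cost u \<omega>"
  using member_le_sum[of k "{..<N}" "\<lambda>k. stage_cost u k \<omega>"] stage_cost_nonneg
  by (fastforce simp: cost_def Qmat_def inner_outer_self intro: add_increasing2)

lemma cost_nonneg: "0 \<le> cost u \<omega>"
  by (simp add: cost_def Qmat_def inner_outer_self sum_nonneg stage_cost_nonneg)

lemma Qmat_quadratic_measurable:
  assumes "e \<in> borel_measurable M"
  shows "(\<lambda>\<omega>. e \<omega> \<bullet> (Qmat x k \<omega> *v e \<omega>)) \<in> borel_measurable M"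
  unfolding Qmat_def inner_outer_self
  by (intro borel_measurable_power borel_measurable_inner data_measurable assms)

lemma cost_measurable:
  assumes "u \<in> updating_functions N"
  shows "cost u \<in> borel_measurable M"
  unfolding cost_def[abs_def] stage_cost_def
  by (intro borel_measurable_add borel_measurable_sum borel_measurable_times borel_measurable_const
      borel_measurable_inner Qmat_quadratic_measurable er_measurable upd_measurable assms) auto

text \<open>The cost dominates \<gamma> times the squared norm of every update, and \<gamma> is
  positive. Policies outside the reach of the real-valued integrals therefore have infinite
  cost.\<close>

lemma upd_sq_of_finite_functional:
  assumes u: "u \<in> updating_functions N" and fin: "learning_functional w x eps u M \<gamma> N < \<infinity>"
    and k: "k < N"
  shows "sq_int M (upd u k)"
proof -
  have cost: "integrable M (cost u)"
    using fin cost_measurable[OF u] cost_nonneg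
    by (intro integrableI_nonneg) (auto simp: learning_functional_eq)
  have "integrable M (\<lambda>\<omega>. \<gamma> * (upd u k \<omega> \<bullet> upd u k \<omega>))"
  proof (rule Bochner_Integration.integrable_bound[OF cost])
    show "(\<lambda>\<omega>. \<gamma> * (upd u k \<omega> \<bullet> upd u k \<omega>)) \<in> borel_measurable M"
      by (intro borel_measurable_times borel_measurable_const borel_measurable_inner upd_measurable u k)
    have "norm (\<gamma> * (upd u k \<omega> \<bullet> upd u k \<omega>)) \<le> norm (cost u \<omega>)" for \<omega>
      using order_trans[OF stage_cost_ge cost_ge_stage[OF k]] cost_nonneg \<gamma>_pos by simp
    then show "AE \<omega> in M. norm (\<gamma> * (upd u k \<omega> \<bullet> upd u k \<omega>)) \<le> norm (cost u \<omega>)"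
      by simp
  qed
  then show ?thesis
    using \<gamma>_pos upd_measurable[OF u k] by (simp add: sq_int_iff_inner)
qed

text \<open>The deviation of the update from the optimal one;
  \<open>est u k \<omega> - What k \<omega>\<close> is a version of the conditional mean of the
  error.\<close>

definition gap :: "'d policy \<Rightarrow> nat \<Rightarrow> 'a \<Rightarrow> real^'d" where
  "gap u k \<omega> = upd u k \<omega> - L k *v (est u k \<omega> - What k \<omega>)"

lemma gap_G: "u \<in> updating_functions N \<Longrightarrow> k < N \<Longrightarrow> gap u k \<in> borel_measurable (G k)"
  unfolding gap_def[abs_def]
  by (intro borel_measurable_diff borel_measurable_matrix upd_G est_G What_measurable)

lemma gap_sq: "(\<And>j. j < N \<Longrightarrow> sq_int M (upd u j)) \<Longrightarrow> k < N \<Longrightarrow> sq_int M (gap u k)"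
  unfolding gap_def[abs_def]
  by (intro sq_int_diff sq_int_matrix est_sq What_sq) auto

text \<open>The unavoidable price at stage \<open>k\<close> of having to estimate
  \<open>w\<close>.\<close>

definition residual_cost :: "nat \<Rightarrow> real" where
  "residual_cost k = (\<integral>\<omega>. (L k *v (w \<omega> - What k \<omega>)) \<bullet> (S k *v (L k *v (w \<omega> - What k \<omega>))) \<partial>M)"

definition gap_cost :: "'d policy \<Rightarrow> nat \<Rightarrow> real" where
  "gap_cost u k = (\<integral>\<omega>. gap u k \<omega> \<bullet> (S k *v gap u k \<omega>) \<partial>M)"

definition optimal_cost :: real where
  "optimal_cost = (\<integral>\<omega>. w \<omega> \<bullet> (K 0 *v w \<omega>) \<partial>M) + (\<Sum>k<N. residual_cost k)"

context
  fixes u :: "'d policy"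
  assumes u: "u \<in> updating_functions N" and upd_sq: "\<And>k. k < N \<Longrightarrow> sq_int M (upd u k)"
begin

lemma stage_cost_integrable:
  assumes k: "k < N"
  shows "integrable M (stage_cost u k)"
proof -
  have "sq_int M (er u k)"
    using k by (intro er_sq upd_sq) simp
  with k show ?thesis
    unfolding stage_cost_def[abs_def]
    by (intro Bochner_Integration.integrable_add integrable_past_quadratic integrable_mult_right
        sq_int_inner er_past u upd_sq) auto
qed

text \<open>One step of dynamic programming; the two costs on the right come from splitting
  \<open>u - L e\<close> into the gap and \<open>L\<close> times the estimation residual, which are orthogonal.\<close>

lemma stage_cost_step:
  assumes k: "k < N"
  shows "(\<integral>\<omega>. stage_cost u k \<omega> \<partial>M) + (\<integral>\<omega>. er u (Suc k) \<omega> \<bullet> (K (Suc k) *v er u (Suc k) \<omega>) \<partial>M) =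
    (\<integral>\<omega>. er u k \<omega> \<bullet> (K k *v er u k \<omega>) \<partial>M) + (gap_cost u k + residual_cost k)"
proof -
  let ?B = "K (Suc k)"
  let ?d = "\<lambda>\<omega>. upd u k \<omega> - L k *v er u k \<omega>"
  have B: "sym_psd ?B"
    using k by (intro sym_psd_K) simp
  have e: "sq_int M (er u k)" and e': "sq_int M (er u (Suc k))"
    using k by (auto intro!: er_sq upd_sq)
  note v = upd_sq[OF k]
  have ep: "er u k \<in> borel_measurable (past k)"
    using k by (intro er_past u) simp
  have d: "sq_int M ?d"
    by (intro sq_int_diff sq_int_matrix v e)
  note int = sq_int_inner sq_int_matrix e e' v d
  have sq: "er u (Suc k) \<omega> \<bullet> (?B *v er u (Suc k) \<omega>) + \<gamma> * (upd u k \<omega> \<bullet> upd u k \<omega>) =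
      ?d \<omega> \<bullet> (S k *v ?d \<omega>) + er u k \<omega> \<bullet> ((?B - F k) *v er u k \<omega>)" for \<omega>
    using complete_square[OF B \<gamma>_pos, of "er u k \<omega>" "upd u k \<omega>"]
    by (simp add: Lmat_def Fmat_def err_def algebra_simps)
  have "(\<integral>\<omega>. stage_cost u k \<omega> \<partial>M) + (\<integral>\<omega>. er u (Suc k) \<omega> \<bullet> (?B *v er u (Suc k) \<omega>) \<partial>M) =
      (\<integral>\<omega>. er u k \<omega> \<bullet> (Qmat x k \<omega> *v er u k \<omega>) \<partial>M) +
      (\<integral>\<omega>. er u (Suc k) \<omega> \<bullet> (?B *v er u (Suc k) \<omega>) + \<gamma> * (upd u k \<omega> \<bullet> upd u k \<omega>) \<partial>M)"
    unfolding stage_cost_def by (simp add: int integrable_past_quadratic[OF ep e])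
  \<comment> \<open>Independence replaces \<open>Qmat x k\<close> by \<open>EQ k\<close>, and the
    square is completed in the rest.\<close>
  also have "\<dots> = (\<integral>\<omega>. er u k \<omega> \<bullet> (EQ k *v er u k \<omega>) \<partial>M) +
      ((\<integral>\<omega>. ?d \<omega> \<bullet> (S k *v ?d \<omega>) \<partial>M) + (\<integral>\<omega>. er u k \<omega> \<bullet> ((?B - F k) *v er u k \<omega>) \<partial>M))"
    unfolding sq integral_past_quadratic[OF ep e]
    by (subst Bochner_Integration.integral_add) (intro int, intro int, rule refl)
  also have "\<dots> = (\<integral>\<omega>. er u k \<omega> \<bullet> (EQ k *v er u k \<omega>) + er u k \<omega> \<bullet> ((?B - F k) *v er u k \<omega>) \<partial>M) +
      (\<integral>\<omega>. ?d \<omega> \<bullet> (S k *v ?d \<omega>) \<partial>M)"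
    by (subst Bochner_Integration.integral_add) (intro int, intro int, simp)
  also have "(\<lambda>\<omega>. er u k \<omega> \<bullet> (EQ k *v er u k \<omega>) + er u k \<omega> \<bullet> ((?B - F k) *v er u k \<omega>)) =
      (\<lambda>\<omega>. er u k \<omega> \<bullet> (K k *v er u k \<omega>))"
    by (simp add: K_step[OF k] matrix_vector_mult_add_rdistrib inner_add_right add.commute)
  also have "(\<integral>\<omega>. ?d \<omega> \<bullet> (S k *v ?d \<omega>) \<partial>M) = gap_cost u k + residual_cost k"
  proof -
    \<comment> \<open>The error is \<open>est u k \<omega> - What k \<omega>\<close> minus the
      residual \<open>w \<omega> - What k \<omega>\<close>.\<close>
    have "?d \<omega> = gap u k \<omega> + L k *v (w \<omega> - What k \<omega>)" for \<omega>
      by (simp add: gap_def err_def matrix_vector_mult_diff_distrib)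
    then show ?thesis
      using integral_residual_split[OF gap_G[OF u k] gap_sq[OF upd_sq k] shift_transpose[OF B \<gamma>_pos], of "L k"]
      by (simp add: gap_cost_def residual_cost_def)
  qed
  finally show ?thesis .
qed

lemma cost_integrable: "integrable M (cost u)"
proof -
  have "sq_int M (er u N)"
    by (intro er_sq upd_sq)
  then show ?thesis
    unfolding cost_def[abs_def]
    by (intro Bochner_Integration.integrable_add Bochner_Integration.integrable_sum
        integrable_past_quadratic er_past u stage_cost_integrable) auto
qed

lemma integral_cost: "(\<integral>\<omega>. cost u \<omega> \<partial>M) = optimal_cost + (\<Sum>k<N. gap_cost u k)"
proof -
  \<comment> \<open>The first \<open>m\<close> stages with cost-to-go matrix \<open>K m\<close> as
    terminal weight. Each increment of \<open>m\<close> is one step of dynamic programming, and at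
    \<open>m = N\<close> the weight is the mean of the true terminal one.\<close>
  have "(\<Sum>k<m. \<integral>\<omega>. stage_cost u k \<omega> \<partial>M) + (\<integral>\<omega>. er u m \<omega> \<bullet> (K m *v er u m \<omega>) \<partial>M) =
      (\<integral>\<omega>. w \<omega> \<bullet> (K 0 *v w \<omega>) \<partial>M) + (\<Sum>k<m. gap_cost u k + residual_cost k)" if "m \<le> N" for m
    using that
  proof (induction m)
    case 0
    then show ?case
      by (simp add: err_def matrix_vec_uminus)
  next
    case (Suc m)
    then show ?case
      using stage_cost_step[of m] by simp
  qed
  from this[of N] have "(\<Sum>k<N. \<integral>\<omega>. stage_cost u k \<omega> \<partial>M) + (\<integral>\<omega>. er u N \<omega> \<bullet> (EQ N *v er u N \<omega>) \<partial>M) =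
      optimal_cost + (\<Sum>k<N. gap_cost u k)"
    by (simp add: K_N optimal_cost_def sum.distrib)
  moreover have eN: "er u N \<in> borel_measurable (past N)" "sq_int M (er u N)"
    by (intro er_past u order_refl) (intro er_sq upd_sq)
  moreover have "(\<integral>\<omega>. cost u \<omega> \<partial>M) =
      (\<Sum>k<N. \<integral>\<omega>. stage_cost u k \<omega> \<partial>M) + (\<integral>\<omega>. er u N \<omega> \<bullet> (Qmat x N \<omega> *v er u N \<omega>) \<partial>M)"
    unfolding cost_def using stage_cost_integrable
    by (subst Bochner_Integration.integral_add[OF _ integrable_past_quadratic[OF eN]])
      (auto intro!: Bochner_Integration.integral_sum)
  ultimately show ?thesis
    using integral_past_quadratic[OF eN] by simp
qed

lemma learning_functional_value:
  "learning_functional w x eps u M \<gamma> N = ennreal (optimal_cost + (\<Sum>k<N. gap_cost u k))"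
  unfolding learning_functional_eq integral_cost[symmetric]
  by (rule nn_integral_eq_integral[OF cost_integrable]) (simp add: cost_nonneg)

end

section \<open>Minimizers are the policies with vanishing gaps\<close>

lemma gap_quadratic_ge: "k < N \<Longrightarrow> v \<bullet> (S k *v v) \<ge> \<gamma> * (v \<bullet> v)"
  by (rule shift_inner_ge[OF sym_psd_K \<gamma>_pos]) simp

lemma gap_quadratic_nonneg: "k < N \<Longrightarrow> 0 \<le> v \<bullet> (S k *v v)"
  using gap_quadratic_ge[of k v] \<gamma>_pos by (smt (verit) inner_ge_zero mult_nonneg_nonneg)

lemma gap_cost_nonneg: "k < N \<Longrightarrow> 0 \<le> gap_cost u k"
  unfolding gap_cost_def by (intro Bochner_Integration.integral_nonneg gap_quadratic_nonneg)

text \<open>A nonnegative integrand with zero integral vanishes almost surely, and the form of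
  \<open>S k\<close> is definite.\<close>

lemma gap_cost_eq_0_iff:
  assumes "\<And>j. j < N \<Longrightarrow> sq_int M (upd u j)" and k: "k < N"
  shows "gap_cost u k = 0 \<longleftrightarrow> (AE \<omega> in M. gap u k \<omega> = 0)"
proof -
  have "v \<bullet> (S k *v v) = 0 \<longleftrightarrow> v = 0" for v
  proof
    assume "v \<bullet> (S k *v v) = 0"
    then have "v \<bullet> v \<le> 0"
      using gap_quadratic_ge[OF k, of v] \<gamma>_pos by (simp add: mult_le_0_iff)
    then show "v = 0"
      by (metis inner_eq_zero_iff inner_ge_zero order_antisym)
  qed simp
  moreover have "gap_cost u k = 0 \<longleftrightarrow> (AE \<omega> in M. gap u k \<omega> \<bullet> (S k *v gap u k \<omega>) = 0)"
    unfolding gap_cost_def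
    by (intro integral_nonneg_eq_0_iff_AE sq_int_inner sq_int_matrix gap_sq assms)
      (auto intro: gap_quadratic_nonneg[OF k])
  ultimately show ?thesis
    by simp
qed

text \<open>The estimate is the sum of the updates stored in the information vector, and
  \<open>What k\<close> factors through the observed data. So the desired update is a measurable
  function of the information vector.\<close>

lemma optimal_policy_exists:
  "\<exists>u\<in>updating_functions N. \<forall>k. AE \<omega> in M. gap u k \<omega> = 0"
proof -
  have "\<exists>g\<in>borel_measurable (PiM {..k} (\<lambda>_. borel)). \<forall>\<omega>\<in>space M. What k \<omega> $ i = g (obs k \<omega>)" for k i
    by (rule doob_dynkin_real[OF obs_funcset])
      (use borel_measurable_component[OF What_measurable] in \<open>simp add: G_def\<close>)
  then obtain g where g: "\<And>k i. g k i \<in> borel_measurable (PiM {..k} (\<lambda>_. borel))"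
      "\<And>k i \<omega>. \<omega> \<in> space M \<Longrightarrow> What k \<omega> $ i = g k i (obs k \<omega>)"
    by metis
  \<comment> \<open>No recursion over \<open>k\<close> is needed: the past updates are read off from
    \<open>snd I\<close>.\<close>
  define u :: "'d policy" where
    "u k I = L k *v ((\<Sum>j<k. snd I j) - (\<chi> i. g k i (fst I)))" for k I
  have "u k \<in> borel_measurable (info_space k)" for k
  proof -
    have "(\<lambda>I. snd I j) \<in> borel_measurable (info_space k)" if "j < k" for j
      unfolding info_space_def using that
      by (intro measurable_compose[OF measurable_snd measurable_component_singleton]) simp
    moreover have "(\<lambda>I. g k i (fst I)) \<in> borel_measurable (info_space k)" for i
      unfolding info_space_def by (intro measurable_compose[OF measurable_fst] g)
    ultimately show ?thesis
      unfolding u_def[abs_def]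
      by (intro borel_measurable_matrix borel_measurable_diff borel_measurable_sum
          borel_measurable_vecI[of "\<lambda>I. \<chi> i. g k i (fst I)"]) auto
  qed
  then have "u \<in> updating_functions N"
    by (simp add: updating_functions_def)
  moreover have "gap u k \<omega> = 0" if "\<omega> \<in> space M" for k \<omega>
  proof -
    have "(\<Sum>j<k. snd (info w x eps u k \<omega>) j) = est u k \<omega>"
      unfolding estimate_eq_sum by (intro sum.cong) (auto simp: info_def)
    moreover have "(\<chi> i. g k i (fst (info w x eps u k \<omega>))) = What k \<omega>"
      using g(2)[OF that] by (simp add: vec_eq_iff info_def obs_def)
    ultimately show ?thesis
      by (simp add: gap_def update_info u_def)
  qed
  ultimately show ?thesis
    by (intro bexI[of _ u] allI AE_I2)
qed

text \<open>Carries square-integrability one step forward in time without assuming finite cost: the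
  update agrees almost surely with a linear image of square-integrable vectors.\<close>

lemma upd_sq_of_gap_0:
  assumes u: "u \<in> updating_functions N" and k: "k < N" "\<And>j. j < k \<Longrightarrow> sq_int M (upd u j)"
    and gap: "AE \<omega> in M. gap u k \<omega> = 0"
  shows "sq_int M (upd u k)"
proof (rule sq_int_cong_AE)
  show "sq_int M (\<lambda>\<omega>. L k *v (est u k \<omega> - What k \<omega>))"
    by (intro sq_int_matrix sq_int_diff est_sq What_sq k)
  show "AE \<omega> in M. upd u k \<omega> = L k *v (est u k \<omega> - What k \<omega>)"
    using gap by eventually_elim (simp add: gap_def)
qed (rule upd_measurable[OF u k(1)])

lemma upd_sq_of_all_gaps_0:
  assumes u: "u \<in> updating_functions N" and gap: "\<And>k. k < N \<Longrightarrow> AE \<omega> in M. gap u k \<omega> = 0"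
  shows "k < N \<Longrightarrow> sq_int M (upd u k)"
  by (induction k rule: less_induct) (auto intro: upd_sq_of_gap_0[OF u] gap)

text \<open>Every finite cost is \<open>optimal_cost\<close> plus nonnegative gap costs, and some
  policy attains \<open>optimal_cost\<close>. So a minimizer must have zero gap cost at each
  stage.\<close>

lemma solves_iff_gaps_0:
  assumes u: "u \<in> updating_functions N"
  shows "solves_OLL M w x eps \<gamma> N u \<longleftrightarrow> (\<forall>k<N. AE \<omega> in M. gap u k \<omega> = 0)"
proof
  assume gap: "\<forall>k<N. AE \<omega> in M. gap u k \<omega> = 0"
  then have sq: "sq_int M (upd u k)" if "k < N" for k
    using upd_sq_of_all_gaps_0[OF u _ that] by blast
  have "(\<Sum>k<N. gap_cost u k) = 0"
    using gap gap_cost_eq_0_iff[OF sq] by simp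
  then have opt: "learning_functional w x eps u M \<gamma> N = ennreal optimal_cost"
    using learning_functional_value[OF u sq] by simp
  have "ennreal optimal_cost \<le> learning_functional w x eps v M \<gamma> N" if v: "v \<in> updating_functions N" for v
  proof (cases "learning_functional w x eps v M \<gamma> N < \<infinity>")
    case True
    then show ?thesis
      using learning_functional_value[OF v upd_sq_of_finite_functional[OF v True]]
        sum_nonneg[of "{..<N}" "gap_cost v"] gap_cost_nonneg
      by (simp add: ennreal_leI)
  qed (simp add: not_less top.extremum_unique)
  with u opt show "solves_OLL M w x eps \<gamma> N u"
    by (simp add: solves_OLL_def)
next
  assume "solves_OLL M w x eps \<gamma> N u"
  then have le: "learning_functional w x eps u M \<gamma> N \<le> learning_functional w x eps v M \<gamma> N"
    if "v \<in> updating_functions N" for v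
    using that by (simp add: solves_OLL_def)
  obtain v where v: "v \<in> updating_functions N" "\<And>k. AE \<omega> in M. gap v k \<omega> = 0"
    using optimal_policy_exists by blast
  note v_sq = upd_sq_of_all_gaps_0[OF v]
  have v_val: "learning_functional w x eps v M \<gamma> N = ennreal optimal_cost"
    using learning_functional_value[OF v(1) v_sq] gap_cost_eq_0_iff[OF v_sq] v(2) by simp
  have "learning_functional w x eps u M \<gamma> N < \<infinity>"
    using le[OF v(1)] v_val by (simp add: le_less_trans)
  note u_sq = upd_sq_of_finite_functional[OF u this]
  \<comment> \<open>\<open>ennreal\<close> truncates negative reals, so nonnegativity of
    \<open>optimal_cost\<close> is required before the comparison can be read in the reals.\<close>
  have "optimal_cost = (\<integral>\<omega>. cost v \<omega> \<partial>M)"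
    using integral_cost[OF v(1) v_sq] gap_cost_eq_0_iff[OF v_sq] v(2) by simp
  then have "0 \<le> optimal_cost"
    by (simp add: cost_nonneg)
  moreover have "ennreal (optimal_cost + (\<Sum>k<N. gap_cost u k)) \<le> ennreal optimal_cost"
    using le[OF v(1)] v_val learning_functional_value[OF u u_sq] by simp
  ultimately have "(\<Sum>k<N. gap_cost u k) \<le> 0"
    by (simp add: ennreal_le_iff)
  then have "(\<Sum>k<N. gap_cost u k) = 0"
    using sum_nonneg[of "{..<N}" "gap_cost u"] gap_cost_nonneg by simp
  then have "\<forall>k<N. gap_cost u k = 0"
    using sum_nonneg_eq_0_iff[of "{..<N}" "gap_cost u"] gap_cost_nonneg by simp
  then show "\<forall>k<N. AE \<omega> in M. gap u k \<omega> = 0"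
    using gap_cost_eq_0_iff[OF u_sq] by blast
qed

text \<open>The condition is closed-loop: error and information are those produced by
  \<open>u\<close> itself. Equality is almost sure because a conditional expectation is determined
  only up to null sets.\<close>

definition certainty_equivalent :: "'d policy \<Rightarrow> nat \<Rightarrow> bool" where
  "certainty_equivalent u k \<longleftrightarrow> (AE \<omega> in M.
     (u k \<circ> tilde k) (tilde_info w x eps u k \<omega>) =
     L k *v cond_exp_given M (er u k) (tilde_info w x eps u k) (info_space k) \<omega>)"

text \<open>The error is an observable estimate minus \<open>w\<close>, and its conditioning algebra
  is \<open>G k\<close>. Square-integrability is assumed only for earlier updates, so that the
  equivalence can be used in an induction over time.\<close>

lemma certainty_equivalent_iff_gap_0:
  assumes u: "u \<in> updating_functions N" and k: "k < N" "\<And>j. j < k \<Longrightarrow> sq_int M (upd u j)"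
  shows "certainty_equivalent u k \<longleftrightarrow> (AE \<omega> in M. gap u k \<omega> = 0)"
proof -
  have ce: "AE \<omega> in M. cond_exp_given M (er u k) (tilde_info w x eps u k) (info_space k) \<omega> = est u k \<omega> - What k \<omega>"
    using cond_exp_shifted_parameter[OF est_G[OF u k(1)] est_sq[OF k(2)]]
    unfolding cond_exp_given_def tilde_info_algebra[OF u k(1)] err_def .
  have "(u k \<circ> tilde k) (tilde_info w x eps u k \<omega>) = upd u k \<omega>" for \<omega>
    by (simp add: tilde_tilde_info update_info)
  then have "certainty_equivalent u k \<longleftrightarrow> (AE \<omega> in M. upd u k \<omega> =
      L k *v cond_exp_given M (er u k) (tilde_info w x eps u k) (info_space k) \<omega>)"
    by (simp add: certainty_equivalent_def)
  also have "\<dots> \<longleftrightarrow> (AE \<omega> in M. gap u k \<omega> = 0)"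
    by (rule eventually_cong[OF ce]) (simp add: gap_def)
  finally show ?thesis .
qed

lemma solves_iff_certainty_equivalent:
  assumes u: "u \<in> updating_functions N"
  shows "solves_OLL M w x eps \<gamma> N u \<longleftrightarrow> (\<forall>k<N. certainty_equivalent u k)"
  unfolding solves_iff_gaps_0[OF u]
proof
  assume gap: "\<forall>k<N. AE \<omega> in M. gap u k \<omega> = 0"
  then have sq: "sq_int M (upd u k)" if "k < N" for k
    using upd_sq_of_all_gaps_0[OF u _ that] by blast
  with gap show "\<forall>k<N. certainty_equivalent u k"
    using certainty_equivalent_iff_gap_0[OF u] by simp
next
  assume ce: "\<forall>k<N. certainty_equivalent u k"
  \<comment> \<open>Finite cost is not known here. Square-integrable earlier updates turn certainty
    equivalence at \<open>k\<close> into a zero gap, which makes the update at \<open>k\<close>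
    square-integrable in turn.\<close>
  have sq: "k < N \<Longrightarrow> sq_int M (upd u k)" for k
  proof (induction k rule: less_induct)
    case (less k)
    then have "AE \<omega> in M. gap u k \<omega> = 0"
      using ce certainty_equivalent_iff_gap_0[OF u less.prems] by simp
    with less show ?case
      by (intro upd_sq_of_gap_0[OF u less.prems]) auto
  qed
  with ce show "\<forall>k<N. AE \<omega> in M. gap u k \<omega> = 0"
    using certainty_equivalent_iff_gap_0[OF u] by simp
qed

lemma solution_exists: "\<exists>u. solves_OLL M w x eps \<gamma> N u"
proof -
  obtain u where "u \<in> updating_functions N" "\<And>k. AE \<omega> in M. gap u k \<omega> = 0"
    using optimal_policy_exists by blast
  then show ?thesis
    using solves_iff_gaps_0 by blast
qed

end

theorem proposition1:
  fixes M :: "'a measure"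
    and w :: "'a \<Rightarrow> real^'d::finite"
    and x :: "nat \<Rightarrow> 'a \<Rightarrow> real^'d"
    and eps :: "nat \<Rightarrow> 'a \<Rightarrow> real"
    and \<Sigma>w :: "real^'d^'d"
    and \<sigma> \<gamma> :: real
    and N :: nat
  assumes "prob_space M"
    and "mutually_independent M w x eps"
    and "has_covariance M w \<Sigma>w" and "integral\<^sup>L M w = 0"
    and "\<And>k. \<exists>S. has_covariance M (x k) S" and "\<And>k. integral\<^sup>L M (x k) = 0"
    and "\<And>k. integrable M (eps k)" and "\<And>k. integral\<^sup>L M (eps k) = 0"
    and "\<And>k. integrable M (\<lambda>\<omega>. (eps k \<omega>)\<^sup>2)" and "\<And>k. prob_space.variance M (eps k) = \<sigma>\<^sup>2"
    and "N \<ge> 1" and "\<gamma> > 0"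
  shows
    "(\<exists>u. solves_OLL M w x eps \<gamma> N u) \<and>
     (\<forall>u\<in>updating_functions N.
        solves_OLL M w x eps \<gamma> N u \<longleftrightarrow>
        (\<forall>k<N. AE \<omega> in M.
           (u k \<circ> tilde k) (tilde_info w x eps u k \<omega>) =
           Lmat M x \<gamma> N k *v
             cond_exp_given M (err w x eps u k) (tilde_info w x eps u k) (info_space k) \<omega>)) \<and>
     (\<forall>k\<le>N. \<forall>\<omega>\<in>space M. sym_psd (Kmat M x \<gamma> N k \<omega>)) \<and>
     (\<forall>k<N. invertible (Kbar M x \<gamma> N (Suc k) + \<gamma> *\<^sub>R mat 1) \<and> sym_psd (Fmat M x \<gamma> N k)) \<and>
     (\<forall>k\<le>N. sym_psd (Kbar M x \<gamma> N k)) \<and>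
     (\<forall>k<N. Kbar M x \<gamma> N k =
        Kbar M x \<gamma> N (Suc k)
        - Kbar M x \<gamma> N (Suc k) ** matrix_inv (Kbar M x \<gamma> N (Suc k) + \<gamma> *\<^sub>R mat 1)
            ** Kbar M x \<gamma> N (Suc k)
        + integral\<^sup>L M (Qmat x k))"
proof -
  interpret online_learning M w x eps \<gamma> N
  proof (intro online_learning.intro online_learning_axioms.intro)
    show "sq_int M w"
      using assms(3,4) by (rule has_covariance_sq_int)
    show "sq_int M (x k)" for k
      using assms(5,6) has_covariance_sq_int by blast
    show "eps k \<in> borel_measurable M" for k
      using assms(7) by (rule borel_measurable_integrable)
  qed (fact assms)+
  have psd: "sym_psd (K (Suc k))" if "k < N" for k
    using that by (intro sym_psd_K) simp
  have "invertible (S k)" "sym_psd (F k)" if "k < N" for k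
    unfolding Fmat_def
    by (intro shift_invertible sym_psd_correction psd that \<gamma>_pos)+
  moreover have "K k = K (Suc k) - K (Suc k) ** matrix_inv (S k) ** K (Suc k) + EQ k" if "k < N" for k
    using K_step[OF that] by (simp add: Fmat_def)
  ultimately show ?thesis
    using solution_exists solves_iff_certainty_equivalent sym_psd_Kmat sym_psd_K
    unfolding certainty_equivalent_def by blast
qed

end
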